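(* Let $X$ be a quasi-Banach space. The following conditions are equivalent. (i) $X$ is locally convex. (ii) There exists $0<\delta\le 1$ such that for every Lipschitz map $F\colon\mathbb{R}\to X$ there is $s\in\mathbb{R}$ such that $\delta\,\mathrm{Lip}(F;s)\le \mathrm{lip}(F;s)$. (iii) There is $0<\delta\le 1$ such that for every Lipschitz map $F\colon\mathbb{R}\to X$ there is $s\in\mathbb{R}$ such that $$\delta\limsup_{t\to s}\frac{\|F(t)-F(s)\|_X}{|t-s|}\le\liminf_{t\to s}\frac{\|F(t)-F(s)\|_X}{|t-s|}.$$ (iv) There is $0<\delta\le 1$ such that for every Lipschitz map $F\colon\mathbb{R}\to X$, $$\delta\limsup_{t\to s}\frac{\|F(t)-F(s)\|_X}{|t-s|}\le\liminf_{t\to s}\frac{\|F(t)-F(s)\|_X}{|t-s|}$$ for almost every $s\in\mathbb{R}$.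
   Context: A quasi-norm on a real or complex vector space $X$ is a map $\|\cdot\|_X\colon X\to[0,\infty)$ with $\|x\|_X>0$ for $x\neq 0$, $\|\alpha x\|_X=|\alpha|\,\|x\|_X$ for all scalars $\alpha$, and $\|x+y\|_X\le\kappa(\|x\|_X+\|y\|_X)$ for some constant $\kappa\ge 1$ and all $x,y\in X$. It induces a metrizable linear topology on $X$; $X$ is a quasi-Banach space if it is complete. $X$ is locally convex if the origin has a neighbourhood basis of absolutely convex sets; equivalently, there is a norm on $X$ equivalent to $\|\cdot\|_X$. A map $F\colon\mathbb{R}\to X$ is Lipschitz if there is $L<\infty$ with $\|F(t)-F(s)\|_X\le L|t-s|$ for all $s,t$. For such $F$ and $s\in\mathbb{R}$, $$\mathrm{lip}(F;s)=\liminf_{r\to0^+}\ \sup_{t\in B(s,r)}\frac{\|F(t)-F(s)\|_X}{r},\qquad \mathrm{Lip}(F;s)=\limsup_{r\to0^+}\ \sup_{t\in B(s,r)}\frac{\|F(t)-F(s)\|_X}{r},$$ where $B(s,r)=\{t\in\mathbb{R}: |t-s|\le r\}$. "Almost every" refers to Lebesgue measure. *)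

theory Defs
  imports "HOL-Analysis.Analysis"
begin

text \<open>
  By the Gelfand--Mazur theorem, the fields of class \<^class>\<open>real_normed_field\<close> are, up to isometric
  isomorphism, precisely \<^typ>\<open>real\<close> and \<^typ>\<open>complex\<close>, so real and complex spaces are treated at once.
\<close>

locale quasi_normed_space = vector_space scl
  for scl :: "'k::real_normed_field \<Rightarrow> 'a::ab_group_add \<Rightarrow> 'a" +
  fixes qnorm :: "'a \<Rightarrow> real"
  assumes qnorm_nonneg: "0 \<le> qnorm x"
    and qnorm_pos: "x \<noteq> 0 \<Longrightarrow> 0 < qnorm x"
    and qnorm_scale: "qnorm (scl a x) = norm a * qnorm x"
    and qnorm_quasi_triangle:
      "\<exists>\<kappa>\<ge>1. \<forall>x y. qnorm (x + y) \<le> \<kappa> * (qnorm x + qnorm y)"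

locale quasi_banach_space = quasi_normed_space scl qnorm
  for scl :: "'k::real_normed_field \<Rightarrow> 'a::ab_group_add \<Rightarrow> 'a" and qnorm :: "'a \<Rightarrow> real" +
  assumes qnorm_complete:
    "(\<forall>e>0. \<exists>N. \<forall>m\<ge>N. \<forall>n\<ge>N. qnorm (u m - u n) < e)
       \<Longrightarrow> \<exists>l. (\<lambda>n::nat. qnorm (u n - l)) \<longlonglongrightarrow> 0"

text \<open>The balls of a quasi-norm need not be open; they are only required to be neighbourhoods.\<close>

definition qnorm_topology :: "('a::ab_group_add \<Rightarrow> real) \<Rightarrow> 'a topology" where
  "qnorm_topology qnorm = topology (\<lambda>U. \<forall>x\<in>U. \<exists>e>0. {y. qnorm (y - x) < e} \<subseteq> U)"

lemma openin_qnorm_topology: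
  "openin (qnorm_topology qnorm) U \<longleftrightarrow> (\<forall>x\<in>U. \<exists>e>0. {y. qnorm (y - x) < e} \<subseteq> U)"
proof -
  have "istopology (\<lambda>U. \<forall>x\<in>U. \<exists>e>0. {y. qnorm (y - x) < e} \<subseteq> U)"
    unfolding istopology_def
  proof (intro conjI allI impI ballI)
    fix S T x
    assume S: "\<forall>x\<in>S. \<exists>e>0. {y. qnorm (y - x) < e} \<subseteq> S"
      and T: "\<forall>x\<in>T. \<exists>e>0. {y. qnorm (y - x) < e} \<subseteq> T" and x: "x \<in> S \<inter> T"
    from S x obtain d where d: "d > 0" "{y. qnorm (y - x) < d} \<subseteq> S" by blast
    from T x obtain e where e: "e > 0" "{y. qnorm (y - x) < e} \<subseteq> T" by blast
    from d e show "\<exists>e>0. {y. qnorm (y - x) < e} \<subseteq> S \<inter> T"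
      by (intro exI[of _ "min d e"]) auto
  next
    fix \<K> x
    assume K: "\<forall>K\<in>\<K>. \<forall>x\<in>K. \<exists>e>0. {y. qnorm (y - x) < e} \<subseteq> K" and "x \<in> \<Union>\<K>"
    then obtain K where "K \<in> \<K>" "x \<in> K" by blast
    with K obtain e where "e > 0" "{y. qnorm (y - x) < e} \<subseteq> K" by blast
    with \<open>K \<in> \<K>\<close> show "\<exists>e>0. {y. qnorm (y - x) < e} \<subseteq> \<Union>\<K>" by blast
  qed
  then show ?thesis
    unfolding qnorm_topology_def by (simp add: topology_inverse')
qed

definition absolutely_convex ::
    "('k::real_normed_field \<Rightarrow> 'a::ab_group_add \<Rightarrow> 'a) \<Rightarrow> 'a set \<Rightarrow> bool" where
  "absolutely_convex scl S \<longleftrightarrow>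
     (\<forall>x\<in>S. \<forall>y\<in>S. \<forall>a b. norm a + norm b \<le> 1 \<longrightarrow> scl a x + scl b y \<in> S)"

definition locally_convex ::
    "('k::real_normed_field \<Rightarrow> 'a::ab_group_add \<Rightarrow> 'a) \<Rightarrow> ('a \<Rightarrow> real) \<Rightarrow> bool" where
  "locally_convex scl qnorm \<longleftrightarrow>
     neighbourhood_base_at 0 (absolutely_convex scl) (qnorm_topology qnorm)"

definition lipschitz_map :: "('a::ab_group_add \<Rightarrow> real) \<Rightarrow> (real \<Rightarrow> 'a) \<Rightarrow> bool" where
  "lipschitz_map qnorm F \<longleftrightarrow> (\<exists>L. \<forall>s t. qnorm (F t - F s) \<le> L * \<bar>t - s\<bar>)"

definition lower_lip :: "('a::ab_group_add \<Rightarrow> real) \<Rightarrow> (real \<Rightarrow> 'a) \<Rightarrow> real \<Rightarrow> ereal" where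
  "lower_lip qnorm F s =
     Liminf (at_right 0) (\<lambda>r. SUP t\<in>cball s r. ereal (qnorm (F t - F s) / r))"

definition upper_lip :: "('a::ab_group_add \<Rightarrow> real) \<Rightarrow> (real \<Rightarrow> 'a) \<Rightarrow> real \<Rightarrow> ereal" where
  "upper_lip qnorm F s =
     Limsup (at_right 0) (\<lambda>r. SUP t\<in>cball s r. ereal (qnorm (F t - F s) / r))"

end

theory Submission
  imports Defs
begin

text \<open>
  If \<open>X\<close> is locally convex, pass to an equivalent norm. For a Lipschitz map into a normed space the
  metric derivative exists almost everywhere: let \<open>S\<close> be the set of points where the difference
  quotients have lower limit below \<open>a\<close> and upper limit above \<open>b > a\<close>. In an interval across which the
  map is faster than \<open>b\<close>, intervals across which it is slower than \<open>a\<close> cover \<open>S\<close> in the sense of Vitali,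
  so by the triangle inequality \<open>S\<close> fills at most a fixed proportion \<open>\<theta> < 1\<close> of it. Since the fast
  intervals form a Vitali cover of \<open>S\<close> as well, \<open>S\<close> is null.

  If \<open>X\<close> is not locally convex, some polygons run at arbitrarily small speed but end far from their
  starting point. Suitably normalised, they give 1-Lipschitz paths from \<open>0\<close> to a vector of quasi-norm at
  least \<open>1 / 2\<close> that are as slow as desired at small scales. Running such paths back and forth with rapidly
  decreasing wave lengths and adding up yields a Lipschitz map that near every point is slow at some
  arbitrarily small scales and fast at others.
\<close>

section \<open>Metric derivatives\<close>

text \<open>The Vitali covering theorem yields countably many disjoint balls that cover
  \<open>S\<close> up to a null set. They all lie in \<open>U\<close>, so their union has finite
  measure and finitely many of them exhaust it up to \<open>e\<close>. The family \<open>K\<close>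
  consists of pairs of centre and radius, which keeps the end points of an interval
  accessible.\<close>

lemma Vitali_covering_finite:
  fixes S U :: "'n::euclidean_space set"
  assumes S: "S \<in> sets lebesgue" and U: "U \<in> lmeasurable" and e: "e > 0"
    and K: "\<And>c r. (c, r) \<in> K \<Longrightarrow> 0 < r \<and> cball c r \<subseteq> U"
    and cov: "\<And>x d. x \<in> S \<Longrightarrow> 0 < d \<Longrightarrow> \<exists>c r. (c, r) \<in> K \<and> x \<in> cball c r \<and> r < d"
  obtains C where "finite C" "C \<subseteq> K" "pairwise (\<lambda>i j. disjnt (cball (fst i) (snd i)) (cball (fst j) (snd j))) C"
    "measure lebesgue (S - (\<Union>i\<in>C. cball (fst i) (snd i))) < e"
proof -
  let ?B = "\<lambda>i::'n\<times>real. cball (fst i) (snd i)"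
  have 1: "\<And>i. i \<in> K \<Longrightarrow> 0 < snd i" using K by auto
  have 2: "\<exists>i. i \<in> K \<and> x \<in> cball (fst i) (snd i) \<and> snd i < d" if "x \<in> S" "0 < d" for x d
    using cov[OF that] by force
  obtain C where C: "countable C" "C \<subseteq> K" "pairwise (\<lambda>i j. disjnt (?B i) (?B j)) C"
    "negligible (S - (\<Union>i\<in>C. ?B i))"
    by (rule Vitali_covering_theorem_cballs[of K snd S fst, OF 1 2])
  have sub: "(\<Union>i\<in>C'. ?B i) \<subseteq> U" if "C' \<subseteq> C" for C'
    using K C(2) that by fastforce
  obtain D where D: "D \<subseteq> ?B ` C" "finite D"
      "measure lebesgue (\<Union>(?B ` C)) - e < measure lebesgue (\<Union>D)"
  proof (rule measure_countable_Union_approachable[of "?B ` C" e "measure lebesgue U"])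
    fix D' assume "D' \<subseteq> ?B ` C" "finite D'"
    then have "\<Union>D' \<subseteq> U" "\<Union>D' \<in> lmeasurable"
      using sub[of C] by (auto intro!: fmeasurable.finite_Union)
    then show "measure lebesgue (\<Union>D') \<le> measure lebesgue U"
      using U by (intro measure_mono_fmeasurable) auto
  qed (use C e in auto)
  obtain C' where C': "C' \<subseteq> C" "finite C'" "D = ?B ` C'"
    using finite_subset_image[OF D(2,1)] by blast
  have m: "\<Union>(?B ` C) \<in> lmeasurable"
    by (rule fmeasurableI2[OF U sub]) (use C(1) in \<open>auto intro!: sets.countable_UN''\<close>)
  have m': "\<Union>(?B ` C') \<in> lmeasurable" using C' by auto
  have diff: "measure lebesgue (\<Union>(?B ` C) - \<Union>(?B ` C')) < e"
    using D(3) C' m m' by (subst measurable_measure_Diff) auto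
  have "measure lebesgue (S - \<Union>(?B ` C'))
      \<le> measure lebesgue ((\<Union>(?B ` C) - \<Union>(?B ` C')) \<union> (S - \<Union>(?B ` C)))"
    by (rule measure_mono_fmeasurable)
       (use m m' S C(4) in \<open>auto intro!: fmeasurable.Un intro: fmeasurable_Diff negligible_imp_measurable\<close>)
  also have "\<dots> = measure lebesgue (\<Union>(?B ` C) - \<Union>(?B ` C'))"
    using C(4) m m' by (intro measure_Un_null_set) (auto simp: negligible_iff_null_sets)
  finally have "measure lebesgue (S - \<Union>(?B ` C')) < e" using diff by simp
  moreover have "pairwise (\<lambda>i j. disjnt (?B i) (?B j)) C'"
    by (rule pairwise_subset[OF C(3) C'(1)])
  ultimately show ?thesis
    using that[of C'] C' C(2) by blast
qed

text \<open>Walk from \<open>s\<close> to \<open>t\<close> through the end points of the disjoint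
  intervals and charge the gaps at the rate \<open>L\<close>. Instead of sorting \<open>I\<close>,
  the induction picks any interval, which splits the others into those on its left and those on its
  right.\<close>

lemma chain_bound:
  fixes D :: "real \<Rightarrow> real \<Rightarrow> real"
  assumes tri: "\<And>x y z. D x z \<le> D x y + D y z" and lip: "\<And>x y. D x y \<le> L * \<bar>y - x\<bar>"
    and "finite I" and "pairwise (\<lambda>i j. disjnt (cball (c i) (r i)) (cball (c j) (r j))) I"
    and "\<And>i. i \<in> I \<Longrightarrow> 0 < r i \<and> s \<le> c i - r i \<and> c i + r i \<le> t" and "s \<le> t"
  shows "D s t \<le> (\<Sum>i\<in>I. D (c i - r i) (c i + r i)) + L * (t - s - (\<Sum>i\<in>I. 2 * r i))"
  using assms(3-)
proof (induction I arbitrary: s t rule: finite_psubset_induct)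
  case (psubset I)
  show ?case
  proof (cases "I = {}")
    case True
    then show ?thesis using lip[of s t] psubset.prems by simp
  next
    case False
    then obtain k where k: "k \<in> I" by blast
    define A where "A = {i \<in> I. c i + r i \<le> c k - r k}"
    define B where "B = {i \<in> I. c k + r k \<le> c i - r i}"
    have pos: "0 < r i" if "i \<in> I" for i using psubset.prems(2)[OF that] by simp
    have split: "i \<in> A \<or> i \<in> B" if i: "i \<in> I" "i \<noteq> k" for i
    proof (rule ccontr)
      assume n: "\<not> (i \<in> A \<or> i \<in> B)"
      then have n: "c k - r k < c i + r i" "c i - r i < c k + r k"
        using i by (auto simp: A_def B_def)
      have "max (c i - r i) (c k - r k) \<in> cball (c i) (r i) \<inter> cball (c k) (r k)"
        using n pos[OF i(1)] pos[OF k] by (auto simp: dist_real_def)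
      moreover have "disjnt (cball (c i) (r i)) (cball (c k) (r k))"
        using psubset.prems(1) i k by (auto simp: pairwise_def)
      ultimately show False by (auto simp: disjnt_def)
    qed
    have I: "I = insert k (A \<union> B)" using split k by (auto simp: A_def B_def)
    have kn: "k \<notin> A" "k \<notin> B" using pos[OF k] by (auto simp: A_def B_def)
    have disj: "A \<inter> B = {}"
    proof (rule ccontr)
      assume "A \<inter> B \<noteq> {}"
      then obtain i where "i \<in> I" "c i + r i \<le> c k - r k" "c k + r k \<le> c i - r i"
        by (auto simp: A_def B_def)
      then show False using pos[of i] pos[OF k] by linarith
    qed
    have fin: "finite A" "finite B" using psubset.hyps by (auto simp: A_def B_def)
    have sum: "(\<Sum>i\<in>I. f i) = f k + (sum f A + sum f B)" for f :: "_ \<Rightarrow> real"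
      unfolding I using kn fin disj by (simp add: sum.union_disjoint)
    have psub: "A \<subset> I" "B \<subset> I" using kn k unfolding A_def B_def by blast+
    have ltk: "s \<le> c k - r k" "c k + r k \<le> t" using psubset.prems(2)[OF k] by auto
    have "D s (c k - r k) \<le> (\<Sum>i\<in>A. D (c i - r i) (c i + r i)) + L * (c k - r k - s - (\<Sum>i\<in>A. 2 * r i))"
      using psubset.prems ltk psub
      by (intro psubset.IH pairwise_subset[OF psubset.prems(1)]) (auto simp: A_def)
    moreover have "D (c k + r k) t \<le> (\<Sum>i\<in>B. D (c i - r i) (c i + r i)) + L * (t - (c k + r k) - (\<Sum>i\<in>B. 2 * r i))"
      using psubset.prems ltk psub
      by (intro psubset.IH pairwise_subset[OF psubset.prems(1)]) (auto simp: B_def)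
    moreover have "D s t \<le> D s (c k - r k) + D (c k - r k) (c k + r k) + D (c k + r k) t"
      using tri[of s t "c k - r k"] tri[of "c k - r k" t "c k + r k"] by linarith
    ultimately show ?thesis unfolding sum by (simp add: algebra_simps)
  qed
qed

text \<open>Two Vitali coverings are nested. Slow intervals inside a fast one give the density bound
  \<open>dens\<close>; fast intervals inside an open set slightly larger than a bounded piece of
  \<open>S\<close> then show that the measure of this piece is at most \<open>\<theta>\<close> times
  itself, hence zero.\<close>

lemma negligible_oscillation:
  fixes D :: "real \<Rightarrow> real \<Rightarrow> real"
  assumes sym: "\<And>x y. D x y = D y x" and tri: "\<And>x y z. D x z \<le> D x y + D y z"
    and lip0: "\<And>x y. D x y \<le> L0 * \<bar>y - x\<bar>" and ab: "a < b"
  shows "negligible {s. \<forall>n. (\<exists>t. 0 < \<bar>t - s\<bar> \<and> \<bar>t - s\<bar> < 1 / Suc n \<and> D s t < a * \<bar>t - s\<bar>) \<and>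
                          (\<exists>t. 0 < \<bar>t - s\<bar> \<and> \<bar>t - s\<bar> < 1 / Suc n \<and> b * \<bar>t - s\<bar> < D s t)}"
    (is "negligible {s. \<forall>n. ?A n s \<and> ?B n s}")
proof -
  define S where "S = {s. \<forall>n. ?A n s \<and> ?B n s}"
  define L where "L = max (max L0 b) 0 + 1"
  have L: "b < L" "0 < L" "L0 \<le> L" by (auto simp: L_def)
  have lip: "D x y \<le> L * \<bar>y - x\<bar>" for x y
    using lip0[of x y] mult_right_mono[of L0 L "\<bar>y - x\<bar>"] L(3) by linarith
  \<comment> \<open>If slow intervals of total length \<open>T\<close> lie in an interval of length
    \<open>l\<close> that is crossed faster than \<open>b\<close>, then
    \<open>b * l < a * T + L * (l - T)\<close>, that is, \<open>T < \<theta> * l\<close>. Raising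
    the Lipschitz constant above \<open>b\<close> makes \<open>\<theta>\<close> positive.\<close>
  define \<theta> where "\<theta> = (L - b) / (L - a)"
  have th: "0 < \<theta>" "\<theta> < 1" using L ab by (auto simp: \<theta>_def field_simps)
  have cont: "continuous_on UNIV (\<lambda>s. D s t)" for t
  proof (rule lipschitz_on_continuous_on)
    show "L-lipschitz_on UNIV (\<lambda>s. D s t)"
    proof (rule lipschitz_onI)
      fix x y
      show "dist (D x t) (D y t) \<le> L * dist x y"
        using tri[of x t y] tri[of y t x] lip[of x y] sym[of x y]
        by (auto simp: dist_real_def abs_minus_commute)
    qed (use L in auto)
  qed
  \<comment> \<open>Both conditions are open in \<open>s\<close>, so \<open>S\<close> is a countable
    intersection of open sets and therefore Borel.\<close>
  have "open {s. ?A n s}" for n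
    unfolding Collect_ex_eq
    by (intro open_UN ballI open_Collect_conj open_Collect_less continuous_intros cont)
  moreover have "open {s. ?B n s}" for n
    unfolding Collect_ex_eq
    by (intro open_UN ballI open_Collect_conj open_Collect_less continuous_intros cont)
  moreover have "S = (\<Inter>n. {s. ?A n s} \<inter> {s. ?B n s})" by (auto simp: S_def)
  ultimately have "S \<in> sets borel"
    by (auto intro!: sets.countable_INT' borel_open)
  then have S: "S \<in> sets lebesgue" by simp
  have lm: "S \<inter> B \<in> lmeasurable" if "B \<in> lmeasurable" for B
    by (rule fmeasurableI2[OF that]) (use S that in auto)
  \<comment> \<open>The interval with end points \<open>s\<close> and \<open>t\<close> does it, for
    slow and for fast pairs alike. Symmetry of \<open>P\<close> enters because \<open>t\<close> may
    lie on either side of \<open>s\<close>.\<close>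
  have cover: "\<exists>c r. (0 < r \<and> cball c r \<subseteq> U \<and> P (c - r) (c + r)) \<and> s \<in> cball c r \<and> r < d"
    if U: "open U" "s \<in> U" and "0 < d" and P: "\<And>n. \<exists>t. 0 < \<bar>t - s\<bar> \<and> \<bar>t - s\<bar> < 1 / Suc n \<and> P s t"
      and Psym: "\<And>x y. P x y \<Longrightarrow> P y x" for U s d and P :: "real \<Rightarrow> real \<Rightarrow> bool"
  proof -
    obtain e where e: "e > 0" "ball s e \<subseteq> U" using U openE by blast
    obtain n where "1 / Suc n < min d e"
      using \<open>d > 0\<close> e(1) nat_approx_posE[of "min d e"] by auto
    then have n: "1 / Suc n < d" "1 / Suc n < e" by simp_all
    obtain t where t: "0 < \<bar>t - s\<bar>" "\<bar>t - s\<bar> < 1 / Suc n" "P s t" using P by blast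
    define c r where "c = (s + t) / 2" and "r = \<bar>t - s\<bar> / 2"
    have "cball c r \<subseteq> ball s e"
    proof
      fix x assume "x \<in> cball c r"
      then have "\<bar>x - c\<bar> \<le> r" by (simp add: dist_real_def abs_minus_commute)
      moreover have "\<bar>c - s\<bar> = r" by (simp add: c_def r_def abs_if field_simps)
      moreover have "2 * r < e" using n(2) t(2) by (simp add: r_def)
      ultimately show "x \<in> ball s e" by (simp add: dist_real_def)
    qed
    moreover have "(c - r = s \<and> c + r = t) \<or> (c - r = t \<and> c + r = s)"
      by (auto simp: c_def r_def abs_if field_simps)
    moreover have "0 < r" "r < d" using t n(1) unfolding r_def by simp_all
    moreover have "s \<in> cball c r"
      by (auto simp: r_def c_def dist_real_def abs_if field_simps)
    ultimately show ?thesis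
      using t(3) Psym[OF t(3)] e(2) by (metis order_trans)
  qed
  have dens: "measure lebesgue (S \<inter> {s..t}) \<le> \<theta> * (t - s)"
    if st: "s < t" and big: "b * (t - s) < D s t" for s t
  proof (rule field_le_epsilon)
    fix e :: real assume e: "e > 0"
    \<comment> \<open>The length \<open>2 * r\<close> is left unsimplified so that the condition is
      literally an instance of \<open>P (c - r) (c + r)\<close> in \<open>cover\<close>.\<close>
    define K where "K = {(c, r). 0 < r \<and> cball c r \<subseteq> {s<..<t} \<and> D (c - r) (c + r) < a * \<bar>c + r - (c - r)\<bar>}"
    have KU: "0 < r \<and> cball c r \<subseteq> {s<..<t}" if "(c, r) \<in> K" for c r
      using that by (simp add: K_def)
    have S': "S \<inter> {s<..<t} \<in> sets lebesgue" "{s<..<t} \<in> lmeasurable" using S by auto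
    have cov: "\<exists>c r. (c, r) \<in> K \<and> x \<in> cball c r \<and> r < d" if "x \<in> S \<inter> {s<..<t}" "0 < d" for x d
    proof -
      have "\<exists>c r. (0 < r \<and> cball c r \<subseteq> {s<..<t} \<and> D (c - r) (c + r) < a * \<bar>c + r - (c - r)\<bar>) \<and>
        x \<in> cball c r \<and> r < d"
        by (rule cover) (use that in \<open>auto simp: S_def sym abs_minus_commute\<close>)
      then show ?thesis by (simp add: K_def)
    qed
    obtain C where C: "finite C" "C \<subseteq> K"
      "pairwise (\<lambda>i j. disjnt (cball (fst i) (snd i)) (cball (fst j) (snd j))) C"
      "measure lebesgue (S \<inter> {s<..<t} - (\<Union>i\<in>C. cball (fst i) (snd i))) < e"
      by (rule Vitali_covering_finite[OF S' e KU cov])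
    have inC: "0 < snd i" "cball (fst i) (snd i) \<subseteq> {s<..<t}"
        "D (fst i - snd i) (fst i + snd i) < a * (2 * snd i)" if "i \<in> C" for i
    proof -
      have "(fst i, snd i) \<in> K" using C(2) that by auto
      then show "0 < snd i" "cball (fst i) (snd i) \<subseteq> {s<..<t}"
        "D (fst i - snd i) (fst i + snd i) < a * (2 * snd i)"
        unfolding K_def by auto
    qed
    let ?T = "\<Sum>i\<in>C. 2 * snd i"
    have C': "0 < snd i \<and> s \<le> fst i - snd i \<and> fst i + snd i \<le> t" if "i \<in> C" for i
    proof -
      note inC[OF that]
      moreover have "fst i - snd i \<in> cball (fst i) (snd i)" "fst i + snd i \<in> cball (fst i) (snd i)"
        using \<open>0 < snd i\<close> by (auto simp: dist_real_def)
      ultimately have "fst i - snd i \<in> {s<..<t}" "fst i + snd i \<in> {s<..<t}" by blast+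
      then show ?thesis using \<open>0 < snd i\<close> by simp
    qed
    have "b * (t - s) < (\<Sum>i\<in>C. D (fst i - snd i) (fst i + snd i)) + L * (t - s - ?T)"
      using chain_bound[OF tri lip C(1,3) C'] big st by fastforce
    also have "(\<Sum>i\<in>C. D (fst i - snd i) (fst i + snd i)) \<le> (\<Sum>i\<in>C. a * (2 * snd i))"
      using inC(3) by (intro sum_mono less_imp_le)
    finally have *: "(L - a) * ?T < (L - b) * (t - s)"
      by (simp add: sum_distrib_left[symmetric] algebra_simps)
    have ms: "S \<inter> {s..t} \<in> lmeasurable" by (rule lm) auto
    have st_m: "{s, t} \<in> lmeasurable" by (auto intro!: negligible_imp_measurable)
    then have "measure lebesgue (S \<inter> {s..t}) \<le> measure lebesgue
       ((S \<inter> {s<..<t} - (\<Union>i\<in>C. cball (fst i) (snd i))) \<union> ((\<Union>i\<in>C. cball (fst i) (snd i)) \<union> {s, t}))"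
      by (intro measure_mono_fmeasurable fmeasurable.Un fmeasurable_Diff lm fmeasurable.finite_UN)
        (use S C(1) in auto)
    also have "\<dots> \<le> measure lebesgue (S \<inter> {s<..<t} - (\<Union>i\<in>C. cball (fst i) (snd i)))
        + measure lebesgue ((\<Union>i\<in>C. cball (fst i) (snd i)) \<union> {s, t})"
      using S C(1) by (intro measure_Un_le sets.Un sets.Diff sets.Int sets.finite_UN) auto
    also have "measure lebesgue ((\<Union>i\<in>C. cball (fst i) (snd i)) \<union> {s, t}) = measure lebesgue (\<Union>i\<in>C. cball (fst i) (snd i))"
      using C(1) by (intro measure_Un_null_set) (auto simp: negligible_iff_null_sets[symmetric])
    also have "\<dots> \<le> (\<Sum>i\<in>C. measure lebesgue (cball (fst i) (snd i)))"
      using C(1) by (intro measure_UNION_le) auto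
    also have "\<dots> = ?T"
      using C' by (intro sum.cong refl) (auto simp: cball_eq_atLeastAtMost dest!: C')
    finally have "measure lebesgue (S \<inter> {s..t}) \<le> ?T + e" using C(4) by simp
    moreover have "?T \<le> \<theta> * (t - s)"
      using * L ab by (simp add: \<theta>_def field_simps)
    ultimately show "measure lebesgue (S \<inter> {s..t}) \<le> \<theta> * (t - s) + e" by simp
  qed
  \<comment> \<open>On a bounded piece the measure is finite, so an inequality of the form
    \<open>m \<le> \<theta> * m + e\<close> can be solved for it.\<close>
  have "negligible (S \<inter> cball 0 R)" for R :: real
  proof -
    let ?S = "S \<inter> cball 0 R"
    have mS: "?S \<in> lmeasurable" by (rule lm) auto
    have small: "measure lebesgue ?S * (1 - \<theta>) \<le> e" if e: "e > 0" for e
    proof -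
      obtain U where U: "open U" "?S \<subseteq> U" "U - ?S \<in> lmeasurable" "emeasure lebesgue (U - ?S) < ennreal (e / 2)"
        using sets_lebesgue_outer_open[of ?S "e / 2"] mS e by auto
      have mU: "U \<in> lmeasurable"
        using fmeasurable.Un[OF U(3) mS] U(2) by (simp add: Un_absorb2)
      have "measure lebesgue (U - ?S) < e / 2"
        using U(4) e by (simp add: emeasure_eq_measure2[OF U(3)] ennreal_less_iff)
      then have Ub: "measure lebesgue U < measure lebesgue ?S + e / 2"
        using measurable_measure_Diff[OF mU _ U(2)] mS by auto
      define K where "K = {(c, r). 0 < r \<and> cball c r \<subseteq> U \<and> b * \<bar>c + r - (c - r)\<bar> < D (c - r) (c + r)}"
      have KU: "0 < r \<and> cball c r \<subseteq> U" if "(c, r) \<in> K" for c r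
        using that by (simp add: K_def)
      have cov: "\<exists>c r. (c, r) \<in> K \<and> x \<in> cball c r \<and> r < d" if "x \<in> ?S" "0 < d" for x d
      proof -
        have "\<exists>c r. (0 < r \<and> cball c r \<subseteq> U \<and> b * \<bar>c + r - (c - r)\<bar> < D (c - r) (c + r)) \<and>
          x \<in> cball c r \<and> r < d"
          by (rule cover) (use that U(1,2) in \<open>auto simp: S_def sym abs_minus_commute\<close>)
        then show ?thesis by (simp add: K_def)
      qed
      obtain C where C: "finite C" "C \<subseteq> K"
        "pairwise (\<lambda>i j. disjnt (cball (fst i) (snd i)) (cball (fst j) (snd j))) C"
        "measure lebesgue (?S - (\<Union>i\<in>C. cball (fst i) (snd i))) < e / 2"
        by (rule Vitali_covering_finite[OF fmeasurableD[OF mS] mU half_gt_zero[OF e] KU cov])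
      have inC: "0 < snd i" "cball (fst i) (snd i) \<subseteq> U"
          "b * (2 * snd i) < D (fst i - snd i) (fst i + snd i)" if "i \<in> C" for i
      proof -
        have "(fst i, snd i) \<in> K" using C(2) that by auto
        then show "0 < snd i" "cball (fst i) (snd i) \<subseteq> U"
          "b * (2 * snd i) < D (fst i - snd i) (fst i + snd i)"
          unfolding K_def by auto
      qed
      have "measure lebesgue ?S \<le> measure lebesgue
         ((?S - (\<Union>i\<in>C. cball (fst i) (snd i))) \<union> (\<Union>i\<in>C. S \<inter> cball (fst i) (snd i)))"
        by (intro measure_mono_fmeasurable fmeasurable.Un fmeasurable_Diff lm fmeasurable.finite_UN)
          (use S C(1) in auto)
      also have "\<dots> \<le> measure lebesgue (?S - (\<Union>i\<in>C. cball (fst i) (snd i)))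
          + measure lebesgue (\<Union>i\<in>C. S \<inter> cball (fst i) (snd i))"
        using S C(1) by (intro measure_Un_le sets.Un sets.Diff sets.Int sets.finite_UN) auto
      also have "measure lebesgue (\<Union>i\<in>C. S \<inter> cball (fst i) (snd i))
          \<le> (\<Sum>i\<in>C. measure lebesgue (S \<inter> cball (fst i) (snd i)))"
        using C(1) S by (intro measure_UNION_le) auto
      also have "\<dots> \<le> (\<Sum>i\<in>C. \<theta> * measure lebesgue (cball (fst i) (snd i)))"
      proof (rule sum_mono)
        fix i assume "i \<in> C"
        from inC[OF this] show "measure lebesgue (S \<inter> cball (fst i) (snd i)) \<le> \<theta> * measure lebesgue (cball (fst i) (snd i))"
          using dens[of "fst i - snd i" "fst i + snd i"] by (simp add: cball_eq_atLeastAtMost)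
      qed
      also have "\<dots> = \<theta> * measure lebesgue (\<Union>i\<in>C. cball (fst i) (snd i))"
        using C(1,3) by (subst measure_UNION') (auto simp: sum_distrib_left)
      also have "\<dots> \<le> \<theta> * measure lebesgue U"
        using th C(1) inC(2) mU
        by (intro mult_left_mono measure_mono_fmeasurable UN_least) auto
      also have "\<dots> \<le> \<theta> * (measure lebesgue ?S + e / 2)"
        using th Ub by (intro mult_left_mono) auto
      finally have "measure lebesgue ?S * (1 - \<theta>) \<le> \<theta> * (e / 2) + e / 2"
        using C(4) by (simp add: algebra_simps)
      also have "\<dots> \<le> e" using th e by (auto simp: field_simps)
      finally show ?thesis .
    qed
    have "measure lebesgue ?S * (1 - \<theta>) \<le> 0"
      by (rule field_le_epsilon) (use small in auto)
    then have "measure lebesgue ?S = 0"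
      using th by (smt (verit) measure_nonneg mult_pos_pos)
    then show ?thesis using mS by (simp add: negligible_iff_measure)
  qed
  then have "negligible (\<Union>n::nat. S \<inter> cball 0 (real n))"
    by (intro negligible_countable_Union) auto
  moreover have "(\<Union>n::nat. S \<inter> cball 0 (real n)) = S"
    using real_arch_simple by auto
  ultimately show ?thesis by (simp add: S_def)
qed

text \<open>Where the inequality fails, two rationals \<open>p < q\<close> fit strictly between the
  limits, and \<open>s\<close> lies in the null set belonging to this pair. There are only countably
  many pairs.\<close>

lemma AE_Limsup_le_Liminf:
  fixes D :: "real \<Rightarrow> real \<Rightarrow> real"
  assumes sym: "\<And>x y. D x y = D y x" and tri: "\<And>x y z. D x z \<le> D x y + D y z"
    and lip: "\<And>x y. D x y \<le> L * \<bar>y - x\<bar>"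
  shows "AE s in lebesgue. Limsup (at s) (\<lambda>t. ereal (D s t / \<bar>t - s\<bar>))
           \<le> Liminf (at s) (\<lambda>t. ereal (D s t / \<bar>t - s\<bar>))"
proof -
  define N where "N = (\<lambda>a b. {s. \<forall>n.
      (\<exists>t. 0 < \<bar>t - s\<bar> \<and> \<bar>t - s\<bar> < 1 / Suc n \<and> D s t < a * \<bar>t - s\<bar>) \<and>
      (\<exists>t. 0 < \<bar>t - s\<bar> \<and> \<bar>t - s\<bar> < 1 / Suc n \<and> b * \<bar>t - s\<bar> < D s t)})"
  define I where "I = {(p, q). p < (q::rat)}"
  have N: "negligible (N a b)" if "a < b" for a b
    unfolding N_def by (rule negligible_oscillation[OF sym tri lip that])
  have "negligible (\<Union>(p, q)\<in>I. N (of_rat p) (of_rat q))"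
  proof (rule negligible_countable_Union)
    show "countable ((\<lambda>(p, q). N (of_rat p) (of_rat q)) ` I)" by auto
  qed (auto simp: I_def of_rat_less intro!: N)
  moreover have "s \<in> (\<Union>(p, q)\<in>I. N (of_rat p) (of_rat q))"
    if s: "\<not> Limsup (at s) (\<lambda>t. ereal (D s t / \<bar>t - s\<bar>)) \<le> Liminf (at s) (\<lambda>t. ereal (D s t / \<bar>t - s\<bar>))" for s
  proof -
    let ?Q = "\<lambda>t. ereal (D s t / \<bar>t - s\<bar>)"
    obtain q where q: "Liminf (at s) ?Q < ereal (of_rat q)" "ereal (of_rat q) < Limsup (at s) ?Q"
      using s ereal_dense3[of "Liminf (at s) ?Q" "Limsup (at s) ?Q"] by (auto simp: not_le)
    obtain p where p: "Liminf (at s) ?Q < ereal (of_rat p)" "ereal (of_rat p) < ereal (of_rat q)"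
      using q(1) ereal_dense3 by blast
    have "\<exists>t. 0 < \<bar>t - s\<bar> \<and> \<bar>t - s\<bar> < 1 / Suc n \<and> D s t < of_rat p * \<bar>t - s\<bar>" for n
    proof (rule ccontr)
      assume n: "\<not> ?thesis"
      have "eventually (\<lambda>t. ereal (of_rat p) \<le> ?Q t) (at s)"
        unfolding eventually_at
        by (rule exI[of _ "1 / Suc n"]) (use n in \<open>auto simp: dist_real_def field_simps not_less\<close>)
      then show False using Liminf_bounded p(1) by (metis not_le)
    qed
    moreover have "\<exists>t. 0 < \<bar>t - s\<bar> \<and> \<bar>t - s\<bar> < 1 / Suc n \<and> of_rat q * \<bar>t - s\<bar> < D s t" for n
    proof (rule ccontr)
      assume n: "\<not> ?thesis"
      have "eventually (\<lambda>t. ?Q t \<le> ereal (of_rat q)) (at s)"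
        unfolding eventually_at
        by (rule exI[of _ "1 / Suc n"]) (use n in \<open>auto simp: dist_real_def field_simps not_less\<close>)
      then show False using Limsup_bounded q(2) by (metis not_le)
    qed
    moreover have "(p, q) \<in> I" using p by (simp add: I_def of_rat_less)
    ultimately show ?thesis unfolding N_def by blast
  qed
  ultimately show ?thesis
    by (intro AE_I'[OF iffD1[OF negligible_iff_null_sets]]) blast+
qed

section \<open>Quasi-norms and local convexity\<close>

context quasi_normed_space
begin

text \<open>One admissible constant of the quasi-triangle inequality, fixed by choice; it need not
  be the smallest.\<close>

definition quasi_const :: real where
  "quasi_const = (SOME \<kappa>. 1 \<le> \<kappa> \<and> (\<forall>x y. qnorm (x + y) \<le> \<kappa> * (qnorm x + qnorm y)))"

lemma quasi_const: "1 \<le> quasi_const" "qnorm (x + y) \<le> quasi_const * (qnorm x + qnorm y)"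
proof -
  have "\<exists>\<kappa>. 1 \<le> \<kappa> \<and> (\<forall>x y. qnorm (x + y) \<le> \<kappa> * (qnorm x + qnorm y))"
    using qnorm_quasi_triangle by blast
  from someI_ex[OF this] show "1 \<le> quasi_const" "qnorm (x + y) \<le> quasi_const * (qnorm x + qnorm y)"
    unfolding quasi_const_def by blast+
qed

lemma quasi_const_pos: "0 < quasi_const"
  using quasi_const(1) by linarith

lemma qnorm_zero [simp]: "qnorm 0 = 0"
  using qnorm_scale[of 0 0] by simp

lemma qnorm_minus [simp]: "qnorm (- x) = qnorm x"
  using qnorm_scale[of "- 1" x] by simp

lemma qnorm_minus_commute: "qnorm (x - y) = qnorm (y - x)"
  using qnorm_minus[of "x - y"] by simp

lemma quasi_triangle_diff: "qnorm (x - z) \<le> quasi_const * (qnorm (x - y) + qnorm (y - z))"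
  using quasi_const(2)[of "x - y" "y - z"] by simp

text \<open>Splitting off the first summand costs one factor \<open>quasi_const\<close> on
  everything that remains, so later summands carry higher powers. Geometric decay of the summands
  can absorb them.\<close>

lemma qnorm_sum_le:
  "qnorm (\<Sum>i<n. f i) \<le> (\<Sum>i<n. quasi_const ^ Suc i * qnorm (f i))" for f :: "nat \<Rightarrow> 'a"
proof (induction n arbitrary: f)
  case (Suc n)
  have "qnorm (\<Sum>i<Suc n. f i) = qnorm (f 0 + (\<Sum>i<n. f (Suc i)))"
    by (simp add: sum.lessThan_Suc_shift del: sum.lessThan_Suc)
  also have "\<dots> \<le> quasi_const * (qnorm (f 0) + qnorm (\<Sum>i<n. f (Suc i)))"
    by (rule quasi_const)
  also have "\<dots> \<le> quasi_const * (qnorm (f 0) + (\<Sum>i<n. quasi_const ^ Suc i * qnorm (f (Suc i))))"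
    using quasi_const_pos by (intro mult_left_mono add_left_mono Suc.IH) auto
  also have "\<dots> = (\<Sum>i<Suc n. quasi_const ^ Suc i * qnorm (f i))"
    by (simp add: sum.lessThan_Suc_shift sum_distrib_left algebra_simps del: sum.lessThan_Suc)
  finally show ?case .
qed simp

text \<open>A quasi-norm need not be continuous, so the quasi-triangle inequality carries the bound
  to the limit at the price of one factor \<open>quasi_const\<close>.\<close>

lemma qnorm_limit_le:
  assumes lim: "(\<lambda>n. qnorm (u n - l)) \<longlonglongrightarrow> 0" and le: "\<And>n. qnorm (u n) \<le> B"
  shows "qnorm l \<le> quasi_const * B"
proof -
  have "(\<lambda>n. quasi_const * (qnorm (u n - l) + B)) \<longlonglongrightarrow> quasi_const * (0 + B)"
    by (intro tendsto_intros lim)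
  moreover have "qnorm l \<le> quasi_const * (qnorm (u n - l) + B)" for n
  proof -
    have "qnorm l \<le> quasi_const * (qnorm (u n - l) + qnorm (u n))"
      using quasi_const(2)[of "l - u n" "u n"] by (simp add: qnorm_minus_commute)
    also have "\<dots> \<le> quasi_const * (qnorm (u n - l) + B)"
      using quasi_const_pos le by (intro mult_left_mono add_left_mono) auto
    finally show ?thesis .
  qed
  ultimately show ?thesis
    by (intro tendsto_le[OF _ _ tendsto_const]) (auto intro!: always_eventually)
qed

text \<open>Given an absolutely convex set between a small ball and the unit ball, a finite sum is a
  multiple of a convex combination of rescaled summands lying in that set. Conversely, the
  inequality makes the convex hulls of balls small, and these form the required neighbourhood
  base.\<close>

lemma locally_convex_iff:
  "locally_convex scl qnorm \<longleftrightarrow> (\<exists>K. \<forall>xs. qnorm (sum_list xs) \<le> K * sum_list (map qnorm xs))"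
proof
  assume lc: "locally_convex scl qnorm"
  \<comment> \<open>The unit ball need not be open, so the neighbourhood base is applied to its
    interior.\<close>
  define W where "W = {x. \<exists>e>0. {y. qnorm (y - x) < e} \<subseteq> {y. qnorm y < 1}}"
  have "openin (qnorm_topology qnorm) W"
    unfolding openin_qnorm_topology
  proof
    fix x assume "x \<in> W"
    then obtain e where e: "e > 0" "{y. qnorm (y - x) < e} \<subseteq> {y. qnorm y < 1}" by (auto simp: W_def)
    define d where "d = e / (2 * quasi_const)"
    have d: "d > 0" using e quasi_const_pos by (simp add: d_def)
    have "y \<in> W" if y: "qnorm (y - x) < d" for y
    proof -
      have "qnorm (z - x) < e" if z: "qnorm (z - y) < d" for z
      proof -
        have "qnorm (z - x) \<le> quasi_const * (qnorm (z - y) + qnorm (y - x))"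
          by (rule quasi_triangle_diff)
        also have "\<dots> < quasi_const * (d + d)"
          using y z quasi_const_pos by (intro mult_strict_left_mono) auto
        also have "\<dots> = e" using quasi_const_pos by (simp add: d_def)
        finally show ?thesis .
      qed
      then show ?thesis using d e unfolding W_def by blast
    qed
    then show "\<exists>e>0. {y. qnorm (y - x) < e} \<subseteq> W" using d by auto
  qed
  moreover have "0 \<in> W" unfolding W_def by (auto intro!: exI[of _ 1])
  ultimately obtain U V where UV: "openin (qnorm_topology qnorm) U" "absolutely_convex scl V" "0 \<in> U" "U \<subseteq> V" "V \<subseteq> W"
    using lc unfolding locally_convex_def neighbourhood_base_at_def by metis
  then obtain e where e: "e > 0" "{y. qnorm (y - 0) < e} \<subseteq> U"
    unfolding openin_qnorm_topology by blast
  have V1: "qnorm x < 1" if "x \<in> V" for x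
  proof -
    have "x \<in> W" using that UV by blast
    then obtain e where "e > 0" "{y. qnorm (y - x) < e} \<subseteq> {y. qnorm y < 1}" by (auto simp: W_def)
    then show ?thesis by (auto dest: subsetD[of _ _ x])
  qed
  \<comment> \<open>The weight \<open>\<mu>\<close> is arbitrary so that the induction can divide it
    between the head and the rest of the list. The radius \<open>e / 2\<close> puts the rescaled
    summands strictly inside the ball of radius \<open>e\<close>.\<close>
  have in_V: "\<exists>v\<in>V. sum_list xs = scl (of_real \<mu>) v" if "sum_list (map qnorm xs) \<le> e / 2 * \<mu>" for xs \<mu>
    using that
  proof (induction xs arbitrary: \<mu>)
    case Nil
    have "0 \<in> V" using UV by blast
    then show ?case by (auto intro!: bexI[of _ 0])
  next
    case (Cons x xs)
    define \<mu>1 where "\<mu>1 = qnorm x / (e / 2)"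
    define \<mu>2 where "\<mu>2 = \<mu> - \<mu>1"
    have S: "sum_list (map qnorm xs) \<le> e / 2 * \<mu>2"
      using Cons.prems e by (simp add: \<mu>1_def \<mu>2_def right_diff_distrib)
    then obtain v where v: "v \<in> V" "sum_list xs = scl (of_real \<mu>2) v" using Cons.IH by blast
    have "0 \<le> sum_list (map qnorm xs)" by (auto intro!: sum_list_nonneg qnorm_nonneg)
    with S have l2: "\<mu>2 \<ge> 0" using e by (smt (verit) half_gt_zero mult_pos_neg)
    have l1: "\<mu>1 \<ge> 0" using e qnorm_nonneg by (simp add: \<mu>1_def)
    have "\<exists>y\<in>V. x = scl (of_real \<mu>1) y"
    proof (cases "x = 0")
      case True
      then show ?thesis using UV by (auto intro!: bexI[of _ 0])
    next
      case False
      then have p: "\<mu>1 > 0" using e qnorm_pos by (simp add: \<mu>1_def)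
      have "qnorm (scl (of_real (1 / \<mu>1)) x) = e / 2"
        using p e qnorm_pos[OF False] by (simp only: qnorm_scale norm_of_real) (simp add: \<mu>1_def)
      then have "scl (of_real (1 / \<mu>1)) x \<in> V" using e UV(4) by (intro subsetD[OF UV(4)] subsetD[OF e(2)]) auto
      moreover have "x = scl (of_real \<mu>1) (scl (of_real (1 / \<mu>1)) x)"
        using p by (simp flip: of_real_mult)
      ultimately show ?thesis by blast
    qed
    then obtain y where y: "y \<in> V" "x = scl (of_real \<mu>1) y" by blast
    show ?case
    proof (cases "\<mu> = 0")
      case True
      then have "\<mu>1 = 0" "\<mu>2 = 0" using l1 l2 by (auto simp: \<mu>2_def)
      then show ?thesis using y v True by (auto intro!: bexI[of _ v])
    next
      case False
      then have p: "\<mu> > 0" using l1 l2 by (auto simp: \<mu>2_def)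
      define w where "w = scl (of_real (\<mu>1 / \<mu>)) y + scl (of_real (\<mu>2 / \<mu>)) v"
      have "\<mu>1 / \<mu> + \<mu>2 / \<mu> = 1" using p by (simp add: \<mu>2_def field_simps)
      then have "w \<in> V"
        using UV(2) y v l1 l2 p unfolding absolutely_convex_def w_def by (auto simp: norm_divide)
      moreover have "\<mu> * (\<mu>1 / \<mu>) = \<mu>1" "\<mu> * (\<mu>2 / \<mu>) = \<mu>2" using p by auto
      then have "scl (of_real \<mu>) w = x + sum_list xs"
        unfolding w_def scale_right_distrib scale_scale of_real_mult[symmetric] y(2) v(2) by simp
      ultimately show ?thesis by (metis sum_list.Cons)
    qed
  qed
  have "qnorm (sum_list xs) \<le> 2 / e * sum_list (map qnorm xs)" for xs
  proof -
    define \<mu> where "\<mu> = 2 / e * sum_list (map qnorm xs)"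
    have l: "\<mu> \<ge> 0" using e by (auto simp: \<mu>_def intro!: sum_list_nonneg qnorm_nonneg mult_nonneg_nonneg divide_nonneg_nonneg)
    obtain v where v: "v \<in> V" "sum_list xs = scl (of_real \<mu>) v"
      using in_V[of xs \<mu>] e by (auto simp: \<mu>_def)
    then have "qnorm (sum_list xs) = \<mu> * qnorm v" using l by (simp add: qnorm_scale)
    also have "\<dots> \<le> \<mu> * 1" using V1[OF v(1)] l by (intro mult_left_mono) auto
    finally show ?thesis by (simp add: \<mu>_def)
  qed
  then show "\<exists>K. \<forall>xs. qnorm (sum_list xs) \<le> K * sum_list (map qnorm xs)" by blast
next
  assume "\<exists>K. \<forall>xs. qnorm (sum_list xs) \<le> K * sum_list (map qnorm xs)"
  then obtain K where K: "\<And>xs. qnorm (sum_list xs) \<le> K * sum_list (map qnorm xs)" by blast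
  \<comment> \<open>For positive \<open>r\<close> this is the convex hull of the ball
    \<open>{x. qnorm x < r}\<close>: normalising the summands turns a sum of total quasi-norm below
    \<open>r\<close> into a convex combination.\<close>
  define V where "V = (\<lambda>r. {x. \<exists>xs. sum_list xs = x \<and> sum_list (map qnorm xs) < r})"
  have "openin (qnorm_topology qnorm) (V r)" for r
    unfolding openin_qnorm_topology
  proof
    fix x assume "x \<in> V r"
    then obtain xs where xs: "sum_list xs = x" "sum_list (map qnorm xs) < r" by (auto simp: V_def)
    have "y \<in> V r" if "qnorm (y - x) < r - sum_list (map qnorm xs)" for y
      using xs that unfolding V_def by (auto intro!: exI[of _ "(y - x) # xs"])
    then show "\<exists>e>0. {y. qnorm (y - x) < e} \<subseteq> V r"
      using xs by (intro exI[of _ "r - sum_list (map qnorm xs)"]) auto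
  qed
  moreover have "absolutely_convex scl (V r)" if r: "r > 0" for r
    unfolding absolutely_convex_def
  proof (intro ballI allI impI)
    fix x y and a b :: 'k assume xy: "x \<in> V r" "y \<in> V r" and ab: "norm a + norm b \<le> 1"
    obtain xs where xs: "sum_list xs = x" "sum_list (map qnorm xs) < r" using xy by (auto simp: V_def)
    obtain ys where ys: "sum_list ys = y" "sum_list (map qnorm ys) < r" using xy by (auto simp: V_def)
    have scl_sum: "sum_list (map (scl c) zs) = scl c (sum_list zs)" for c zs
      by (induction zs) (auto simp: scale_right_distrib)
    have q_sum: "sum_list (map qnorm (map (scl c) zs)) = norm c * sum_list (map qnorm zs)" for c zs
      by (induction zs) (auto simp: qnorm_scale distrib_left)
    define m where "m = max (sum_list (map qnorm xs)) (sum_list (map qnorm ys))"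
    have m: "0 \<le> m" "m < r"
      using xs ys by (auto simp: m_def le_max_iff_disj intro!: sum_list_nonneg qnorm_nonneg)
    have "norm a * sum_list (map qnorm xs) + norm b * sum_list (map qnorm ys) \<le> norm a * m + norm b * m"
      by (intro add_mono mult_left_mono) (auto simp: m_def)
    also have "\<dots> \<le> m" using mult_right_mono[OF ab m(1)] by (simp add: distrib_right)
    finally have "norm a * sum_list (map qnorm xs) + norm b * sum_list (map qnorm ys) < r"
      using m by simp
    then show "scl a x + scl b y \<in> V r"
      unfolding V_def using xs ys scl_sum q_sum
      by (intro CollectI exI[of _ "map (scl a) xs @ map (scl b) ys"])
        (simp del: map_map)
  qed
  moreover have "\<exists>r>0. V r \<subseteq> W" if W: "openin (qnorm_topology qnorm) W" "0 \<in> W" for W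
  proof -
    obtain e where e: "e > 0" "{y. qnorm (y - 0) < e} \<subseteq> W"
      using W unfolding openin_qnorm_topology by blast
    have "qnorm x < e" if xV: "x \<in> V (e / (\<bar>K\<bar> + 1))" for x
    proof -
      obtain xs where xs: "sum_list xs = x" "sum_list (map qnorm xs) < e / (\<bar>K\<bar> + 1)"
        using xV unfolding V_def by blast
      have "qnorm x \<le> K * sum_list (map qnorm xs)" using K[of xs] xs by simp
      also have "\<dots> \<le> (\<bar>K\<bar> + 1) * sum_list (map qnorm xs)"
        by (intro mult_right_mono sum_list_nonneg) (auto simp: qnorm_nonneg)
      also have "\<dots> < (\<bar>K\<bar> + 1) * (e / (\<bar>K\<bar> + 1))"
        using xs(2) by (intro mult_strict_left_mono) auto
      finally show ?thesis by simp
    qed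
    then show ?thesis using e by (intro exI[of _ "e / (\<bar>K\<bar> + 1)"]) auto
  qed
  moreover have "0 \<in> V r" if "r > 0" for r
    using that unfolding V_def by (auto intro!: exI[of _ "[]"])
  ultimately show "locally_convex scl qnorm"
    unfolding locally_convex_def neighbourhood_base_at_def by (metis order_refl)
qed

text \<open>The Minkowski functional of the convex hull of the unit ball: the largest seminorm below \<open>qnorm\<close>.\<close>

definition hull_norm :: "'a \<Rightarrow> real" where
  "hull_norm x = (INF xs\<in>{xs. sum_list xs = x}. sum_list (map qnorm xs))"

lemma hull_norm_le: "hull_norm (sum_list xs) \<le> sum_list (map qnorm xs)"
  unfolding hull_norm_def
  by (rule cINF_lower) (auto intro!: bdd_belowI[of _ 0] sum_list_nonneg qnorm_nonneg)

lemma hull_norm_greatest: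
  assumes "\<And>xs. sum_list xs = x \<Longrightarrow> B \<le> sum_list (map qnorm xs)"
  shows "B \<le> hull_norm x"
  unfolding hull_norm_def
proof (rule cINF_greatest)
  show "{xs. sum_list xs = x} \<noteq> {}" by (auto intro!: exI[of _ "[x]"])
qed (use assms in auto)

lemma hull_norm_le_qnorm: "hull_norm x \<le> qnorm x"
  using hull_norm_le[of "[x]"] by simp

lemma hull_norm_triangle: "hull_norm (x + y) \<le> hull_norm x + hull_norm y"
proof -
  have "hull_norm (x + y) - hull_norm y \<le> hull_norm x"
  proof (rule hull_norm_greatest)
    fix xs assume xs: "sum_list xs = x"
    have "hull_norm (x + y) - sum_list (map qnorm xs) \<le> hull_norm y"
    proof (rule hull_norm_greatest)
      fix ys assume "sum_list ys = y"
      then show "hull_norm (x + y) - sum_list (map qnorm xs) \<le> sum_list (map qnorm ys)"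
        using hull_norm_le[of "xs @ ys"] xs by simp
    qed
    then show "hull_norm (x + y) - hull_norm y \<le> sum_list (map qnorm xs)" by simp
  qed
  then show ?thesis by simp
qed

lemma hull_norm_minus_le: "hull_norm (- x) \<le> hull_norm x"
proof (rule hull_norm_greatest)
  fix xs assume "sum_list xs = x"
  moreover have "sum_list (map uminus xs) = - sum_list xs" by (induction xs) auto
  ultimately show "hull_norm (- x) \<le> sum_list (map qnorm xs)"
    using hull_norm_le[of "map uminus xs"] by (simp add: comp_def)
qed

lemma hull_norm_minus_commute: "hull_norm (x - y) = hull_norm (y - x)"
  using hull_norm_minus_le[of "x - y"] hull_norm_minus_le[of "y - x"] by simp

text \<open>In the locally convex case \<open>hull_norm\<close> is the equivalent norm to which the
  metric derivative argument applies.\<close>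

lemma locally_convexD:
  assumes "locally_convex scl qnorm"
  obtains K where "1 \<le> K" "\<And>x. qnorm x \<le> K * hull_norm x"
proof -
  obtain K where K: "\<And>xs. qnorm (sum_list xs) \<le> K * sum_list (map qnorm xs)"
    using assms locally_convex_iff by blast
  \<comment> \<open>A constant of at least \<open>1\<close> makes its reciprocal an admissible
    \<open>\<delta>\<close>.\<close>
  define K' where "K' = max K 1"
  have "qnorm x \<le> K' * hull_norm x" for x
  proof -
    have "qnorm x / K' \<le> hull_norm x"
    proof (rule hull_norm_greatest)
      fix xs assume xs: "sum_list xs = x"
      have "qnorm x \<le> K * sum_list (map qnorm xs)" using K[of xs] xs by simp
      also have "\<dots> \<le> K' * sum_list (map qnorm xs)"
        by (intro mult_right_mono sum_list_nonneg) (auto simp: K'_def qnorm_nonneg)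
      finally show "qnorm x / K' \<le> sum_list (map qnorm xs)"
        by (simp add: K'_def field_simps)
    qed
    then show ?thesis by (simp add: K'_def field_simps)
  qed
  then show ?thesis using that[of K'] by (simp add: K'_def)
qed

text \<open>The result on metric derivatives applies to the distance given by
  \<open>hull_norm\<close>. Returning to \<open>qnorm\<close> costs a factor \<open>K\<close> in the
  upper limit only, since \<open>hull_norm\<close> lies below \<open>qnorm\<close>; hence
  \<open>\<delta> = 1 / K\<close>.\<close>

lemma locally_convex_imp_AE:
  assumes "locally_convex scl qnorm"
  shows "\<exists>\<delta>::real. 0 < \<delta> \<and> \<delta> \<le> 1 \<and> (\<forall>F. lipschitz_map qnorm F \<longrightarrow>
    (AE s in lebesgue. ereal \<delta> * Limsup (at s) (\<lambda>t. ereal (qnorm (F t - F s) / \<bar>t - s\<bar>))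
       \<le> Liminf (at s) (\<lambda>t. ereal (qnorm (F t - F s) / \<bar>t - s\<bar>))))"
proof -
  obtain K where K: "1 \<le> K" "\<And>x. qnorm x \<le> K * hull_norm x"
    using locally_convexD[OF assms] by blast
  have "AE s in lebesgue. ereal (1 / K) * Limsup (at s) (\<lambda>t. ereal (qnorm (F t - F s) / \<bar>t - s\<bar>))
       \<le> Liminf (at s) (\<lambda>t. ereal (qnorm (F t - F s) / \<bar>t - s\<bar>))"
    if "lipschitz_map qnorm F" for F
  proof -
    obtain L where L: "\<And>s t. qnorm (F t - F s) \<le> L * \<bar>t - s\<bar>"
      using \<open>lipschitz_map qnorm F\<close> unfolding lipschitz_map_def by blast
    have "AE s in lebesgue. Limsup (at s) (\<lambda>t. ereal (hull_norm (F t - F s) / \<bar>t - s\<bar>))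
           \<le> Liminf (at s) (\<lambda>t. ereal (hull_norm (F t - F s) / \<bar>t - s\<bar>))"
    proof (rule AE_Limsup_le_Liminf)
      fix x y z
      show "hull_norm (F y - F x) = hull_norm (F x - F y)" by (rule hull_norm_minus_commute)
      show "hull_norm (F z - F x) \<le> hull_norm (F y - F x) + hull_norm (F z - F y)"
        using hull_norm_triangle[of "F y - F x" "F z - F y"] by simp
      show "hull_norm (F y - F x) \<le> L * \<bar>y - x\<bar>"
        using L[where s = x and t = y] hull_norm_le_qnorm order_trans by blast
    qed
    then show ?thesis
    proof (rule AE_mp, intro AE_I2 impI)
      fix s :: real
      let ?q = "\<lambda>t. ereal (qnorm (F t - F s) / \<bar>t - s\<bar>)" and ?h = "\<lambda>t. ereal (hull_norm (F t - F s) / \<bar>t - s\<bar>)"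
      assume s: "Limsup (at s) ?h \<le> Liminf (at s) ?h"
      have "ereal (1 / K) * Limsup (at s) ?q = Limsup (at s) (\<lambda>t. ereal (1 / K) * ?q t)"
        using K by (intro Limsup_ereal_mult_left[symmetric]) auto
      also have "\<dots> \<le> Limsup (at s) ?h"
      proof (intro Limsup_mono always_eventually allI)
        fix t
        have "qnorm (F t - F s) / K \<le> hull_norm (F t - F s)"
          using K by (simp add: field_simps)
        then have "qnorm (F t - F s) / K / \<bar>t - s\<bar> \<le> hull_norm (F t - F s) / \<bar>t - s\<bar>"
          by (rule divide_right_mono) simp
        then show "ereal (1 / K) * ?q t \<le> ?h t" by simp
      qed
      also note s
      also have "Liminf (at s) ?h \<le> Liminf (at s) ?q"
        by (intro Liminf_mono always_eventually allI) (simp add: divide_right_mono hull_norm_le_qnorm)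
      finally show "ereal (1 / K) * Limsup (at s) ?q \<le> Liminf (at s) ?q" .
    qed
  qed
  then show ?thesis using K(1) by (intro exI[of _ "1 / K"]) auto
qed

text \<open>For \<open>t\<close> in the ball of radius \<open>r\<close>, dividing by
  \<open>r\<close> gives at most the difference quotient at \<open>t\<close>. The centre itself
  contributes \<open>0\<close>, which is why the bound \<open>y\<close> must be known to be
  nonnegative.\<close>

lemma upper_lip_le_Limsup: "upper_lip qnorm F s \<le> Limsup (at s) (\<lambda>t. ereal (qnorm (F t - F s) / \<bar>t - s\<bar>))"
proof (rule dense_ge)
  let ?Q = "\<lambda>t. ereal (qnorm (F t - F s) / \<bar>t - s\<bar>)"
  fix y assume y: "Limsup (at s) ?Q < y"
  have "0 \<le> Liminf (at s) ?Q" by (intro Liminf_bounded always_eventually) (auto simp: qnorm_nonneg)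
  also have "\<dots> \<le> Limsup (at s) ?Q" by (rule Liminf_le_Limsup) simp
  finally have y0: "0 \<le> y" using y by simp
  obtain d where d: "d > 0" "\<And>t. t \<noteq> s \<Longrightarrow> dist t s < d \<Longrightarrow> ?Q t < y"
    using Limsup_lessD[OF y] unfolding eventually_at by blast
  have "ereal (qnorm (F t - F s) / r) \<le> y" if r: "0 < r" "r < d" and t: "t \<in> cball s r" for r t
  proof (cases "t = s")
    case False
    have ts: "\<bar>t - s\<bar> \<le> r" using t by (simp add: dist_real_def abs_minus_commute)
    then have "qnorm (F t - F s) / r \<le> qnorm (F t - F s) / \<bar>t - s\<bar>"
      using False by (intro divide_left_mono qnorm_nonneg) (auto intro: mult_pos_pos r)
    moreover have "?Q t < y" using d(2)[OF False] ts r by (simp add: dist_real_def)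
    ultimately show ?thesis by (meson ereal_less_eq(3) less_imp_le order_trans)
  qed (use y0 in \<open>simp add: zero_ereal_def\<close>)
  then show "upper_lip qnorm F s \<le> y"
    unfolding upper_lip_def using d(1)
    by (intro Limsup_bounded SUP_least eventually_at_rightI[of 0 d]) (auto intro!: SUP_least)
qed

text \<open>The boundary point \<open>s + r\<close> belongs to the closed ball, and there dividing
  by \<open>r\<close> gives exactly the difference quotient.\<close>

lemma Liminf_le_lower_lip: "Liminf (at s) (\<lambda>t. ereal (qnorm (F t - F s) / \<bar>t - s\<bar>)) \<le> lower_lip qnorm F s"
proof (rule dense_le)
  let ?Q = "\<lambda>t. ereal (qnorm (F t - F s) / \<bar>t - s\<bar>)"
  fix y assume y: "y < Liminf (at s) ?Q"
  obtain d where d: "d > 0" "\<And>t. t \<noteq> s \<Longrightarrow> dist t s < d \<Longrightarrow> y < ?Q t"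
    using less_LiminfD[OF y] unfolding eventually_at by blast
  have "y \<le> (SUP t\<in>cball s r. ereal (qnorm (F t - F s) / r))" if r: "0 < r" "r < d" for r
    using d(2)[of "s + r"] r by (intro SUP_upper2[of "s + r"]) (auto simp: dist_real_def)
  then show "y \<le> lower_lip qnorm F s"
    unfolding lower_lip_def using d(1)
    by (intro Liminf_bounded eventually_at_rightI[of 0 d]) auto
qed

end

section \<open>Slow paths and oscillating maps\<close>

lemma geometric_sum_le:
  fixes \<beta> :: real
  assumes "0 \<le> \<beta>" "\<beta> \<le> 1 / 2"
  shows "(\<Sum>i<n. \<beta> ^ Suc i) \<le> 2 * \<beta>"
proof -
  have "(\<Sum>i<n. \<beta> ^ i) \<le> (\<Sum>i. \<beta> ^ i)"
    using assms by (intro sum_le_suminf summable_geometric) auto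
  also have "\<dots> = 1 / (1 - \<beta>)" using assms by (intro suminf_geometric) auto
  also have "\<dots> \<le> 2" using assms by (simp add: divide_le_eq)
  finally have "\<beta> * (\<Sum>i<n. \<beta> ^ i) \<le> \<beta> * 2" using assms by (intro mult_left_mono) auto
  then show ?thesis by (simp add: sum_distrib_left mult.commute)
qed

lemma sin_lipschitz: "\<bar>sin x - sin y\<bar> \<le> \<bar>x - y\<bar>" for x y :: real
proof -
  have "\<bar>sin x - sin y\<bar> = 2 * \<bar>sin ((x - y) / 2)\<bar> * \<bar>cos ((x + y) / 2)\<bar>"
    by (simp add: sin_diff_sin abs_mult)
  also have "\<dots> \<le> 2 * \<bar>(x - y) / 2\<bar> * 1"
    by (intro mult_mono abs_sin_x_le_abs_x mult_left_mono) auto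
  finally show ?thesis by simp
qed

text \<open>The number \<open>7\<close> is a convenient upper bound for the period
  \<open>2 * pi\<close>.\<close>

lemma sin_value_nearby:
  fixes x c :: real
  obtains y where "\<bar>y - x\<bar> \<le> 7" "sin y = sin c"
proof -
  define n where "n = \<lfloor>(x - c) / (2 * pi)\<rfloor>"
  have "of_int n \<le> (x - c) / (2 * pi)" "(x - c) / (2 * pi) < of_int n + 1"
    unfolding n_def by linarith+
  then have "2 * pi * of_int n \<le> x - c" "x - c < 2 * pi * of_int n + 2 * pi"
    by (auto simp: field_simps)
  moreover have "2 * pi \<le> 7" using pi_less_4 pi_approx by simp
  ultimately have "\<bar>c + 2 * pi * of_int n - x\<bar> \<le> 7" by linarith
  moreover have "sin (c + 2 * pi * of_int n) = sin c"
    by (simp add: sin_add sin_int_2pin cos_int_2pin)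
  ultimately show ?thesis using that by blast
qed

section \<open>Polygonal paths and their oscillating copies\<close>

context quasi_normed_space
begin

text \<open>The path from \<open>0\<close> to \<open>x\<close> at unit speed with respect to
  \<open>qnorm\<close>. It rests before time \<open>0\<close> and after time \<open>qnorm x\<close>,
  so a polygon is simply a sum of shifted segments on the whole line.\<close>

definition segment :: "'a \<Rightarrow> real \<Rightarrow> 'a" where
  "segment x t = scl (of_real (max 0 (min t (qnorm x)) / qnorm x)) x"

primrec polygon :: "'a list \<Rightarrow> real \<Rightarrow> 'a" where
  "polygon [] t = 0"
| "polygon (x # xs) t = segment x t + polygon xs (t - qnorm x)"

lemma segment_simps [simp]:
  "t \<le> 0 \<Longrightarrow> segment x t = 0" "x \<noteq> 0 \<Longrightarrow> qnorm x \<le> t \<Longrightarrow> segment x t = x"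
  using qnorm_nonneg[of x] qnorm_pos[of x] by (auto simp: segment_def max_def min_def)

lemma segment_lipschitz: "qnorm (segment x t - segment x s) \<le> \<bar>t - s\<bar>"
proof (cases "x = 0")
  case False
  let ?c = "\<lambda>t. max 0 (min t (qnorm x))"
  have "segment x t - segment x s = scl (of_real ((?c t - ?c s) / qnorm x)) x"
    by (simp add: segment_def scale_left_diff_distrib[symmetric] diff_divide_distrib)
  then have "qnorm (segment x t - segment x s) = \<bar>?c t - ?c s\<bar>"
    using qnorm_pos[OF False] by (simp only: qnorm_scale norm_of_real) (simp add: abs_divide)
  then show ?thesis by (auto simp: max_def min_def abs_if)
qed (simp add: segment_def)

lemma polygon_nonpos [simp]: "t \<le> 0 \<Longrightarrow> polygon xs t = 0"
  by (induction xs arbitrary: t) (auto simp: qnorm_nonneg order_trans)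

lemma polygon_end:
  assumes "0 \<notin> set xs"
  shows "polygon xs (sum_list (map qnorm xs)) = sum_list xs"
  using assms
proof (induction xs)
  case (Cons x xs)
  have "0 \<le> sum_list (map qnorm xs)" by (auto intro!: sum_list_nonneg qnorm_nonneg)
  then show ?case using Cons by auto
qed simp

text \<open>The constant deteriorates with the number of edges. Its only purpose is to make the
  supremum of the mean speeds finite.\<close>

lemma polygon_lipschitz: "\<exists>L\<ge>0. \<forall>s t. qnorm (polygon xs t - polygon xs s) \<le> L * \<bar>t - s\<bar>"
proof (induction xs)
  case (Cons x xs)
  then obtain L where L: "L \<ge> 0" "\<And>s t. qnorm (polygon xs t - polygon xs s) \<le> L * \<bar>t - s\<bar>" by blast
  have "qnorm (polygon (x # xs) t - polygon (x # xs) s) \<le> quasi_const * (1 + L) * \<bar>t - s\<bar>" for s t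
  proof -
    have "polygon (x # xs) t - polygon (x # xs) s
        = (segment x t - segment x s) + (polygon xs (t - qnorm x) - polygon xs (s - qnorm x))" by simp
    also have "qnorm \<dots> \<le> quasi_const * (qnorm (segment x t - segment x s)
        + qnorm (polygon xs (t - qnorm x) - polygon xs (s - qnorm x)))" by (rule quasi_const)
    also have "\<dots> \<le> quasi_const * (\<bar>t - s\<bar> + L * \<bar>t - s\<bar>)"
      using L(2)[of "t - qnorm x" "s - qnorm x"] quasi_const_pos segment_lipschitz
      by (intro mult_left_mono add_mono) auto
    finally show ?thesis by (simp add: algebra_simps)
  qed
  then show ?case using L(1) quasi_const_pos
    by (intro exI[of _ "quasi_const * (1 + L)"]) auto
qed auto

text \<open>Parameters closer than the shortest edge are separated by at most one vertex, so the
  quasi-triangle inequality is applied only once. The sharper bound near the start serves the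
  induction: just behind the first vertex the remaining polygon still runs along a single
  edge.\<close>

lemma polygon_locally_slow:
  assumes "0 \<notin> set xs"
  shows "\<exists>\<rho>>0. (\<forall>t. 0 \<le> t \<and> t \<le> \<rho> \<longrightarrow> qnorm (polygon xs t) \<le> t) \<and>
    (\<forall>s t. \<bar>t - s\<bar> \<le> \<rho> \<longrightarrow> qnorm (polygon xs t - polygon xs s) \<le> quasi_const * \<bar>t - s\<bar>)"
  using assms
proof (induction xs)
  case Nil
  show ?case using quasi_const_pos by (auto intro!: exI[of _ 1])
next
  case (Cons x xs)
  then obtain \<rho> where \<rho>: "\<rho> > 0" "\<And>t. 0 \<le> t \<Longrightarrow> t \<le> \<rho> \<Longrightarrow> qnorm (polygon xs t) \<le> t"
    "\<And>s t. \<bar>t - s\<bar> \<le> \<rho> \<Longrightarrow> qnorm (polygon xs t - polygon xs s) \<le> quasi_const * \<bar>t - s\<bar>" by auto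
  have x: "x \<noteq> 0" "qnorm x > 0" using Cons.prems qnorm_pos by auto
  define \<rho>' where "\<rho>' = min \<rho> (qnorm x)"
  have le: "\<bar>t - s\<bar> \<le> quasi_const * \<bar>t - s\<bar>" for t s :: real
    using mult_right_mono[OF quasi_const(1), of "\<bar>t - s\<bar>"] by simp
  have low: "qnorm (polygon (x # xs) t - polygon (x # xs) s) \<le> \<bar>t - s\<bar>" if "s \<le> qnorm x" "t \<le> qnorm x" for s t
    using that segment_lipschitz[of x t s] by simp
  have "qnorm (polygon (x # xs) t) \<le> t" if "0 \<le> t" "t \<le> \<rho>'" for t
    using low[of 0 t] that x by (simp add: \<rho>'_def)
  moreover have ordered: "qnorm (polygon (x # xs) t - polygon (x # xs) s) \<le> quasi_const * \<bar>t - s\<bar>"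
    if st: "s \<le> t" "t - s \<le> \<rho>'" for s t
  proof -
    consider "t \<le> qnorm x" | "qnorm x \<le> s" | "s < qnorm x" "qnorm x < t" by linarith
    then show ?thesis
    proof cases
      case 1
      then show ?thesis using low[of s t] st le[of t s] by linarith
    next
      case 2
      then show ?thesis using \<rho>(3)[of "t - qnorm x" "s - qnorm x"] st x by (simp add: \<rho>'_def)
    next
      case 3
      have "qnorm (polygon (x # xs) t - polygon (x # xs) s)
        \<le> quasi_const * (qnorm (polygon (x # xs) t - polygon (x # xs) (qnorm x))
            + qnorm (polygon (x # xs) (qnorm x) - polygon (x # xs) s))"
        by (rule quasi_triangle_diff)
      also have "\<dots> \<le> quasi_const * ((t - qnorm x) + (qnorm x - s))"
      proof (intro mult_left_mono add_mono)
        show "qnorm (polygon (x # xs) t - polygon (x # xs) (qnorm x)) \<le> t - qnorm x"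
          using \<rho>(2)[of "t - qnorm x"] 3 st x by (simp add: \<rho>'_def)
        show "qnorm (polygon (x # xs) (qnorm x) - polygon (x # xs) s) \<le> qnorm x - s"
          using low[of s "qnorm x"] 3 by simp
      qed (use quasi_const_pos in simp)
      finally show ?thesis using st by simp
    qed
  qed
  moreover have "qnorm (polygon (x # xs) t - polygon (x # xs) s) \<le> quasi_const * \<bar>t - s\<bar>"
    if "\<bar>t - s\<bar> \<le> \<rho>'" for s t
    using ordered[of s t] ordered[of t s] that
    by (cases "s \<le> t") (auto simp: qnorm_minus_commute abs_minus_commute simp del: polygon.simps)
  moreover have "\<rho>' > 0" using \<rho> x by (simp add: \<rho>'_def)
  ultimately show ?case by blast
qed

text \<open>These vectors violate the inequality that characterises local convexity. Zero vectors
  are dropped since they would be edges of length zero; the strict inequality excludes the empty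
  list.\<close>

lemma fast_polygon:
  assumes "\<not> locally_convex scl qnorm"
  obtains xs where "0 \<notin> set xs" "0 < sum_list (map qnorm xs)"
    "K * sum_list (map qnorm xs) < qnorm (sum_list xs)"
proof -
  obtain ys where ys: "K * sum_list (map qnorm ys) < qnorm (sum_list ys)"
    using assms locally_convex_iff by (metis not_le)
  define xs where "xs = filter (\<lambda>x. x \<noteq> 0) ys"
  have "sum_list (map qnorm xs) = sum_list (map qnorm ys) \<and> sum_list xs = sum_list ys"
    unfolding xs_def by (induction ys) auto
  then have xs: "K * sum_list (map qnorm xs) < qnorm (sum_list xs)" using ys by simp
  then have "xs \<noteq> []" by auto
  moreover have n0: "0 \<notin> set xs" by (simp add: xs_def)
  ultimately have "0 < sum_list (map qnorm xs)"
    by (cases xs) (auto intro!: add_pos_nonneg sum_list_nonneg simp: qnorm_nonneg qnorm_pos)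
  then show ?thesis using that n0 xs by blast
qed

text \<open>Restricting a polygon to a parameter interval on which its mean speed is almost maximal, and
  rescaling, turns the quotient of chord length and speed into a Lipschitz constant.\<close>

lemma slow_lipschitz_path:
  assumes nlc: "\<not> locally_convex scl qnorm" and \<epsilon>: "\<epsilon> > 0"
  shows "\<exists>g \<rho>. 0 < \<rho> \<and> \<rho> \<le> 1 \<and> g 0 = 0 \<and> 1 / 2 \<le> qnorm (g 1) \<and>
    (\<forall>u v::real. qnorm (g u - g v) \<le> \<bar>u - v\<bar>) \<and>
    (\<forall>u v. \<bar>u - v\<bar> \<le> \<rho> \<longrightarrow> qnorm (g u - g v) \<le> \<epsilon> * \<bar>u - v\<bar>)"
proof -
  obtain xs where xs: "0 \<notin> set xs" "0 < sum_list (map qnorm xs)"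
    "quasi_const / \<epsilon> * sum_list (map qnorm xs) < qnorm (sum_list xs)"
    using fast_polygon[OF nlc] by blast
  define T where "T = sum_list (map qnorm xs)"
  define \<gamma> where "\<gamma> = polygon xs"
  define R where "R = {qnorm (\<gamma> t - \<gamma> s) / (t - s) |s t. s < t}"
  obtain B where B: "\<And>s t. qnorm (\<gamma> t - \<gamma> s) \<le> B * \<bar>t - s\<bar>"
    using polygon_lipschitz[of xs] by (auto simp: \<gamma>_def)
  have bdd: "bdd_above R"
  proof (rule bdd_aboveI[of _ B])
    fix z assume "z \<in> R"
    then obtain s t where "s < t" "z = qnorm (\<gamma> t - \<gamma> s) / (t - s)" by (auto simp: R_def)
    then show "z \<le> B" using B[where s = s and t = t] by (simp add: divide_le_eq)
  qed
  \<comment> \<open>The supremum of the mean speeds is the best Lipschitz constant of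
    \<open>\<gamma>\<close>. The chord from start to end shows that it exceeds
    \<open>quasi_const / \<epsilon>\<close>.\<close>
  define L where "L = Sup R"
  have "qnorm (sum_list xs) / T \<in> R"
    using xs(2) polygon_end[OF xs(1)] unfolding R_def \<gamma>_def T_def
    by (intro CollectI exI[of _ 0] exI[of _ "sum_list (map qnorm xs)"]) simp
  then have "qnorm (sum_list xs) / T \<le> L" using bdd by (simp add: L_def cSup_upper)
  moreover have "quasi_const / \<epsilon> < qnorm (sum_list xs) / T"
    using xs by (simp add: T_def less_divide_eq)
  ultimately have L: "quasi_const / \<epsilon> < L" by linarith
  then have L0: "L > 0" using less_trans[OF divide_pos_pos[OF quasi_const_pos \<epsilon>]] by blast
  have Lip: "qnorm (\<gamma> t - \<gamma> s) \<le> L * \<bar>t - s\<bar>" for s t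
  proof -
    have *: "qnorm (\<gamma> t - \<gamma> s) \<le> L * (t - s)" if "s < t" for s t
    proof -
      have "qnorm (\<gamma> t - \<gamma> s) / (t - s) \<le> L"
        unfolding L_def using that bdd by (intro cSup_upper) (auto simp: R_def)
      then show ?thesis using that by (simp add: divide_le_eq)
    qed
    show ?thesis
      using *[of s t] *[of t s] by (cases s t rule: linorder_cases) (auto simp: qnorm_minus_commute)
  qed
  have "R \<noteq> {}" using \<open>qnorm (sum_list xs) / T \<in> R\<close> by blast
  then obtain z where "z \<in> R" "L / 2 < z"
    using less_cSupD[of R "L / 2"] L0 unfolding L_def by auto
  then obtain s t where st: "s < t" "L / 2 < qnorm (\<gamma> t - \<gamma> s) / (t - s)" by (auto simp: R_def)
  obtain \<rho> where \<rho>: "\<rho> > 0" "\<And>s t. \<bar>t - s\<bar> \<le> \<rho> \<Longrightarrow> qnorm (\<gamma> t - \<gamma> s) \<le> quasi_const * \<bar>t - s\<bar>"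
    using polygon_locally_slow[OF xs(1)] by (auto simp: \<gamma>_def)
  \<comment> \<open>Mapping \<open>{0..1}\<close> onto \<open>{s..t}\<close> and multiplying by
    \<open>c\<close> turns the Lipschitz constant \<open>L\<close> into \<open>1\<close> and the
    local constant \<open>quasi_const\<close> into \<open>quasi_const / L\<close>, which is below
    \<open>\<epsilon>\<close>. The chord, of mean speed above \<open>L / 2\<close>, gets length
    above \<open>1 / 2\<close>.\<close>
  define c where "c = 1 / (L * (t - s))"
  have c: "c > 0" using L0 st by (simp add: c_def)
  define g where "g = (\<lambda>u. scl (of_real c) (\<gamma> (s + u * (t - s)) - \<gamma> s))"
  have g: "qnorm (g u - g v) = c * qnorm (\<gamma> (s + u * (t - s)) - \<gamma> (s + v * (t - s)))" for u v
  proof -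
    have "g u - g v = scl (of_real c) (\<gamma> (s + u * (t - s)) - \<gamma> (s + v * (t - s)))"
      by (simp add: g_def scale_right_diff_distrib)
    then show ?thesis using c by (simp add: qnorm_scale)
  qed
  have dist: "\<bar>s + u * (t - s) - (s + v * (t - s))\<bar> = \<bar>u - v\<bar> * (t - s)" for u v
    using st(1) by (simp add: abs_mult left_diff_distrib[symmetric])
  have "g 0 = 0" by (simp add: g_def)
  moreover have "1 / 2 \<le> qnorm (g 1)"
  proof -
    have "qnorm (g 1) = c * qnorm (\<gamma> t - \<gamma> s)" using g[of 1 0] \<open>g 0 = 0\<close> by simp
    moreover have "L / 2 * (t - s) \<le> qnorm (\<gamma> t - \<gamma> s)" using st by (simp add: less_divide_eq)
    then have "c * (L / 2 * (t - s)) \<le> c * qnorm (\<gamma> t - \<gamma> s)" using c by (intro mult_left_mono) auto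
    moreover have "c * (L / 2 * (t - s)) = 1 / 2" using L0 st by (simp add: c_def)
    ultimately show ?thesis by simp
  qed
  moreover have "qnorm (g u - g v) \<le> \<bar>u - v\<bar>" for u v
  proof -
    have "qnorm (g u - g v) \<le> c * (L * (\<bar>u - v\<bar> * (t - s)))"
      unfolding g using c Lip[of "s + u * (t - s)" "s + v * (t - s)"] dist[of u v]
      by (intro mult_left_mono) auto
    also have "\<dots> = \<bar>u - v\<bar>" using L0 st by (simp add: c_def)
    finally show ?thesis .
  qed
  moreover have "qnorm (g u - g v) \<le> \<epsilon> * \<bar>u - v\<bar>" if "\<bar>u - v\<bar> \<le> min 1 (\<rho> / (t - s))" for u v
  proof -
    have "\<bar>u - v\<bar> * (t - s) \<le> \<rho>" using that st(1) by (simp add: le_divide_eq)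
    then have "qnorm (g u - g v) \<le> c * (quasi_const * (\<bar>u - v\<bar> * (t - s)))"
      unfolding g using c \<rho>(2)[of "s + u * (t - s)" "s + v * (t - s)"] dist[of u v]
      by (intro mult_left_mono) auto
    also have "\<dots> = quasi_const / L * \<bar>u - v\<bar>" using L0 st by (simp add: c_def)
    also have "\<dots> \<le> \<epsilon> * \<bar>u - v\<bar>"
      using L L0 \<epsilon> by (intro mult_right_mono) (auto simp: field_simps)
    finally show ?thesis .
  qed
  ultimately show ?thesis
    using \<rho>(1) st(1) by (intro exI[of _ g] exI[of _ "min 1 (\<rho> / (t - s))"]) auto
qed

text \<open>Composition with the sine runs the path back and forth, and the common factor
  \<open>\<eta>\<close> in time and space preserves Lipschitz constants. Near every point
  \<open>G\<close> takes both the value \<open>0\<close> and the value \<open>\<eta>\<close> times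
  \<open>g 1\<close>. These are at least \<open>\<eta> / 2\<close> apart, so one of them is at
  distance at least \<open>\<eta> / (4 * quasi_const)\<close> from \<open>G s\<close>.\<close>

lemma oscillating_function:
  assumes g: "g 0 = 0" "1 / 2 \<le> qnorm (g 1)" "\<And>u v::real. qnorm (g u - g v) \<le> \<bar>u - v\<bar>"
    "\<And>u v. \<bar>u - v\<bar> \<le> \<rho> \<Longrightarrow> qnorm (g u - g v) \<le> \<epsilon> * \<bar>u - v\<bar>" and \<epsilon>: "0 \<le> \<epsilon>" and \<eta>: "0 < \<eta>"
  defines "G \<equiv> \<lambda>t. scl (of_real \<eta>) (g (sin (t / \<eta>)))"
  shows "qnorm (G t - G s) \<le> \<bar>t - s\<bar>"
    "\<bar>t - s\<bar> \<le> \<eta> * \<rho> \<Longrightarrow> qnorm (G t - G s) \<le> \<epsilon> * \<bar>t - s\<bar>"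
    "qnorm (G t) \<le> \<eta>"
    "\<exists>t. \<bar>t - s\<bar> \<le> 7 * \<eta> \<and> \<eta> / (4 * quasi_const) \<le> qnorm (G t - G s)"
proof -
  have G: "qnorm (G t - G s) = \<eta> * qnorm (g (sin (t / \<eta>)) - g (sin (s / \<eta>)))" for s t
    using \<eta> by (simp add: G_def scale_right_diff_distrib[symmetric] qnorm_scale)
  have sin: "\<bar>sin (t / \<eta>) - sin (s / \<eta>)\<bar> \<le> \<bar>t - s\<bar> / \<eta>" for s t
    using sin_lipschitz[of "t / \<eta>" "s / \<eta>"] \<eta> by (simp add: diff_divide_distrib[symmetric] abs_divide)
  have "qnorm (G t - G s) \<le> \<eta> * (\<bar>t - s\<bar> / \<eta>)"
    unfolding G using \<eta> by (intro mult_left_mono order_trans[OF g(3) sin]) auto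
  then show "qnorm (G t - G s) \<le> \<bar>t - s\<bar>" using \<eta> by simp
  show "qnorm (G t - G s) \<le> \<epsilon> * \<bar>t - s\<bar>" if "\<bar>t - s\<bar> \<le> \<eta> * \<rho>"
  proof -
    have "\<bar>t - s\<bar> / \<eta> \<le> \<rho>" using that \<eta> by (simp add: divide_le_eq mult.commute)
    then have "qnorm (G t - G s) \<le> \<eta> * (\<epsilon> * \<bar>sin (t / \<eta>) - sin (s / \<eta>)\<bar>)"
      unfolding G using \<eta> by (intro mult_left_mono g(4) order_trans[OF sin]) auto
    also have "\<dots> \<le> \<eta> * (\<epsilon> * (\<bar>t - s\<bar> / \<eta>))"
      using \<eta> \<epsilon> by (intro mult_left_mono sin) auto
    finally show ?thesis using \<eta> by simp
  qed
  have "qnorm (g u) \<le> \<bar>u\<bar>" for u using g(3)[of u 0] g(1) by simp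
  then have "qnorm (g (sin (t / \<eta>))) \<le> 1" using abs_sin_le_one order_trans by blast
  then show "qnorm (G t) \<le> \<eta>" using \<eta> by (simp add: G_def qnorm_scale mult_le_cancel_left1)
  obtain y0 where y0: "\<bar>y0 - s / \<eta>\<bar> \<le> 7" "sin y0 = sin 0" by (rule sin_value_nearby)
  obtain y1 where y1: "\<bar>y1 - s / \<eta>\<bar> \<le> 7" "sin y1 = sin (pi / 2)" by (rule sin_value_nearby)
  have near: "\<bar>\<eta> * y - s\<bar> \<le> 7 * \<eta>" if "\<bar>y - s / \<eta>\<bar> \<le> 7" for y
  proof -
    have "\<eta> * y - s = \<eta> * (y - s / \<eta>)" using \<eta> by (simp add: right_diff_distrib)
    then show ?thesis using that \<eta> by (simp add: abs_mult)
  qed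
  have "\<eta> / 2 \<le> \<eta> * qnorm (g 1)" using g(2) \<eta> by simp
  also have "\<dots> = qnorm (G (\<eta> * y1) - G (\<eta> * y0))" using y0 y1 \<eta> g(1) by (simp add: G)
  also have "\<dots> \<le> quasi_const * (qnorm (G (\<eta> * y1) - G s) + qnorm (G s - G (\<eta> * y0)))"
    by (rule quasi_triangle_diff)
  finally have "\<eta> / (2 * quasi_const) \<le> qnorm (G (\<eta> * y1) - G s) + qnorm (G (\<eta> * y0) - G s)"
    using quasi_const_pos by (simp add: divide_le_eq mult.commute qnorm_minus_commute[of "G s"])
  then have "\<eta> / (4 * quasi_const) \<le> qnorm (G (\<eta> * y1) - G s) \<or> \<eta> / (4 * quasi_const) \<le> qnorm (G (\<eta> * y0) - G s)"
    by (auto simp: field_simps)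
  then show "\<exists>t. \<bar>t - s\<bar> \<le> 7 * \<eta> \<and> \<eta> / (4 * quasi_const) \<le> qnorm (G t - G s)"
    using near[OF y0(1)] near[OF y1(1)] by blast
qed

end

section \<open>Superposition of oscillations\<close>

context quasi_banach_space
begin

text \<open>Blocks of summands starting at index \<open>k\<close> are bounded by \<open>B k\<close>,
  so the partial sums are Cauchy and completeness supplies the limit. The remainder estimate then
  follows from \<open>qnorm_limit_le\<close>.\<close>

lemma summation_limit:
  assumes bound: "\<And>k n. qnorm (\<Sum>j<n. y (k + j)) \<le> B k" and B: "B \<longlonglongrightarrow> 0"
  shows "\<exists>l. \<forall>k. qnorm (l - (\<Sum>i<k. y i)) \<le> quasi_const * B k"
proof -
  define u where "u = (\<lambda>n. \<Sum>i<n. y i)"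
  have diff: "u (k + n) - u k = (\<Sum>j<n. y (k + j))" for k n
    unfolding u_def by (induction n) (auto simp: algebra_simps)
  have le: "qnorm (u m - u n) \<le> B (min m n)" for m n
  proof (cases "n \<le> m")
    case True
    then obtain d where "m = n + d" using le_Suc_ex by blast
    then show ?thesis using bound[of n d] diff[of n d] by (simp add: min_absorb2)
  next
    case False
    then obtain d where "n = m + d" using le_Suc_ex[of m n] by auto
    then show ?thesis using bound[of m d] diff[of m d] by (simp add: qnorm_minus_commute[of _ "u n"] qnorm_minus_commute[of "u m"] min_absorb1)
  qed
  have "\<exists>l. (\<lambda>n. qnorm (u n - l)) \<longlonglongrightarrow> 0"
  proof (rule qnorm_complete, intro allI impI)
    fix e :: real assume "e > 0"
    then obtain N where N: "\<And>n. n \<ge> N \<Longrightarrow> B n < e"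
      using order_tendstoD(2)[OF B] unfolding eventually_sequentially by blast
    show "\<exists>N. \<forall>m\<ge>N. \<forall>n\<ge>N. qnorm (u m - u n) < e"
      using le N by (intro exI[of _ N]) (metis le_less_trans min.bounded_iff)
  qed
  then obtain l where l: "(\<lambda>n. qnorm (u n - l)) \<longlonglongrightarrow> 0" by blast
  have "qnorm (l - u k) \<le> quasi_const * B k" for k
  proof (rule qnorm_limit_le)
    show "(\<lambda>n. qnorm ((u (n + k) - u k) - (l - u k))) \<longlonglongrightarrow> 0"
      using LIMSEQ_ignore_initial_segment[OF l, of k] by simp
    show "qnorm (u (n + k) - u k) \<le> B k" for n
      using le[of "n + k" k] by simp
  qed
  then show ?thesis unfolding u_def by blast
qed

text \<open>The map is a sum of oscillations \<open>G k\<close>. At scale \<open>\<tau> k\<close>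
  the earlier summands are slow and the later ones have small amplitude; at scale
  \<open>\<eta> k\<close> the movement of \<open>G k\<close> dominates all others. Thus every point
  sees ratios of order \<open>\<beta>\<close> at some small scales and ratios bounded below
  independently of \<open>\<beta>\<close> at others.\<close>

lemma not_locally_convex_oscillation:
  assumes nlc: "\<not> locally_convex scl qnorm" and \<beta>: "0 < \<beta>" "\<beta> \<le> 1 / (1000 * quasi_const ^ 5)"
  obtains F and \<tau> \<eta> :: "nat \<Rightarrow> real" where "lipschitz_map qnorm F"
    "\<And>k. 0 < \<tau> k" "\<tau> \<longlonglongrightarrow> 0" "\<And>k. 0 < \<eta> k" "\<eta> \<longlonglongrightarrow> 0"
    "\<And>k s t. \<bar>t - s\<bar> \<le> \<tau> k \<Longrightarrow> qnorm (F t - F s) \<le> 6 * quasi_const ^ 3 * \<beta> * \<tau> k"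
    "\<And>k s. \<exists>t. \<bar>t - s\<bar> \<le> 7 * \<eta> k \<and> \<eta> k / (8 * quasi_const ^ 2) \<le> qnorm (F t - F s)"
proof -
  let ?\<kappa> = quasi_const
  have \<kappa>: "1 \<le> ?\<kappa>" "0 < ?\<kappa>" using quasi_const(1) quasi_const_pos by auto
  have pow: "1 \<le> ?\<kappa> ^ n" for n using \<kappa> by (simp add: one_le_power)
  have "1 / (1000 * ?\<kappa> ^ 5) \<le> 1 / 1000" using pow[of 5] \<kappa> by (intro divide_left_mono) auto
  then have \<beta>2: "\<beta> \<le> 1 / 1000" using \<beta>(2) by linarith
  \<comment> \<open>\<open>G k\<close> below has amplitude and wave length of order \<open>\<eta> k = \<theta> * \<tau> k\<close> and looks slow at all scales
    up to \<open>\<tau> (Suc k)\<close>. The factor \<open>\<kappa>\<close> in \<open>\<beta> = \<kappa> * \<theta>\<close> absorbs the powers of \<open>\<kappa>\<close> that iterating the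
    quasi-triangle inequality produces.\<close>
  define \<theta> where "\<theta> = \<beta> / ?\<kappa>"
  have \<theta>: "0 < \<theta>" "?\<kappa> * \<theta> = \<beta>" using \<beta>(1) \<kappa> by (auto simp: \<theta>_def)
  have \<theta>7: "7 * \<theta> \<le> 1" using \<beta>2 \<beta>(1) \<kappa> by (simp add: \<theta>_def divide_le_eq)
  \<comment> \<open>The slowness \<open>\<theta> ^ Suc k\<close> is matched to the factor
    \<open>quasi_const ^ Suc k\<close> of \<open>qnorm_sum_le\<close>: together they give the
    geometric term \<open>\<beta> ^ Suc k\<close>.\<close>
  have "\<forall>k. \<exists>g \<rho>. 0 < \<rho> \<and> \<rho> \<le> 1 \<and> g 0 = 0 \<and> 1 / 2 \<le> qnorm (g 1) \<and>
    (\<forall>u v::real. qnorm (g u - g v) \<le> \<bar>u - v\<bar>) \<and>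
    (\<forall>u v. \<bar>u - v\<bar> \<le> \<rho> \<longrightarrow> qnorm (g u - g v) \<le> \<theta> ^ Suc k * \<bar>u - v\<bar>)"
    using slow_lipschitz_path[OF nlc] \<theta>(1) by (metis zero_less_power)
  then obtain g :: "nat \<Rightarrow> real \<Rightarrow> 'a" and \<rho> where g: "\<And>k. 0 < \<rho> k" "\<And>k. \<rho> k \<le> 1" "\<And>k. g k 0 = 0"
    "\<And>k. 1 / 2 \<le> qnorm (g k 1)" "\<And>k u v. qnorm (g k u - g k v) \<le> \<bar>u - v\<bar>"
    "\<And>k u v. \<bar>u - v\<bar> \<le> \<rho> k \<Longrightarrow> qnorm (g k u - g k v) \<le> \<theta> ^ Suc k * \<bar>u - v\<bar>"
    by metis
  \<comment> \<open>The next scale is the one up to which \<open>G k\<close> is slow, namely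
    \<open>\<eta> k * \<rho> k\<close>.\<close>
  define \<tau> where "\<tau> = rec_nat 1 (\<lambda>k t. \<theta> * t * \<rho> k)"
  define \<eta> where "\<eta> = (\<lambda>k. \<theta> * \<tau> k)"
  have \<tau>_simps: "\<tau> 0 = 1" "\<tau> (Suc k) = \<eta> k * \<rho> k" for k by (simp_all add: \<tau>_def \<eta>_def)
  have \<tau>0: "0 < \<tau> k" for k
    by (induction k) (use \<theta> g(1) in \<open>auto simp: \<tau>_simps \<eta>_def\<close>)
  have \<eta>0: "0 < \<eta> k" for k using \<tau>0 \<theta> by (simp add: \<eta>_def)
  have step: "\<tau> (Suc k) \<le> \<eta> k" for k
    using mult_left_mono[OF g(2)[of k], of "\<eta> k"] \<eta>0[of k] by (simp add: \<tau>_simps)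
  have \<eta>\<tau>: "7 * \<eta> k \<le> \<tau> k" for k
    using mult_right_mono[OF \<theta>7, of "\<tau> k"] \<tau>0[of k] by (simp add: \<eta>_def)
  have "decseq \<tau>"
    by (rule decseq_SucI) (use step \<eta>\<tau> \<eta>0 in \<open>smt (verit)\<close>)
  then have mono: "\<tau> n \<le> \<tau> m" if "m \<le> n" for m n using that by (simp add: decseq_def)
  have \<tau>_geo: "\<tau> (k + j) \<le> \<theta> ^ j * \<tau> k" for k j
  proof (induction j)
    case (Suc j)
    have "\<tau> (k + Suc j) \<le> \<theta> * \<tau> (k + j)" using step[of "k + j"] by (simp add: \<eta>_def)
    also have "\<dots> \<le> \<theta> * (\<theta> ^ j * \<tau> k)" using \<theta> by (intro mult_left_mono Suc) auto
    finally show ?case by (simp add: mult_ac)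
  qed simp
  have \<tau>_lim: "\<tau> \<longlonglongrightarrow> 0"
  proof (rule tendsto_sandwich[OF _ _ tendsto_const])
    show "(\<lambda>k. \<theta> ^ k) \<longlonglongrightarrow> 0" using \<theta> \<theta>7 by (intro LIMSEQ_realpow_zero) auto
    show "\<forall>\<^sub>F k in sequentially. \<tau> k \<le> \<theta> ^ k"
      using \<tau>_geo[of 0] by (intro always_eventually) (simp add: \<tau>_simps)
  qed (use \<tau>0 in \<open>auto intro!: always_eventually less_imp_le\<close>)
  have \<eta>_lim: "\<eta> \<longlonglongrightarrow> 0"
    unfolding \<eta>_def using tendsto_mult_right_zero[OF \<tau>_lim] by simp

  define G where "G = (\<lambda>k t. scl (of_real (\<eta> k)) (g k (sin (t / \<eta> k))))"
  have G1: "qnorm (G k t - G k s) \<le> \<bar>t - s\<bar>"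
    and G2: "\<bar>t - s\<bar> \<le> \<tau> (Suc k) \<Longrightarrow> qnorm (G k t - G k s) \<le> \<theta> ^ Suc k * \<bar>t - s\<bar>"
    and G3: "qnorm (G k t) \<le> \<eta> k"
    and G4: "\<exists>t. \<bar>t - s\<bar> \<le> 7 * \<eta> k \<and> \<eta> k / (4 * ?\<kappa>) \<le> qnorm (G k t - G k s)" for k s t
    unfolding G_def \<tau>_simps
    by (rule oscillating_function[where g = "g k" and \<rho> = "\<rho> k" and \<epsilon> = "\<theta> ^ Suc k"];
        use g \<eta>0 \<theta>(1) in \<open>auto intro: less_imp_le\<close>)+

  have head: "qnorm ((\<Sum>i<k. G i t) - (\<Sum>i<k. G i s)) \<le> 2 * \<beta> * \<bar>t - s\<bar>" if "\<bar>t - s\<bar> \<le> \<tau> k" for k s t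
  proof -
    have "qnorm ((\<Sum>i<k. G i t) - (\<Sum>i<k. G i s)) = qnorm (\<Sum>i<k. G i t - G i s)"
      by (simp add: sum_subtractf)
    also have "\<dots> \<le> (\<Sum>i<k. ?\<kappa> ^ Suc i * qnorm (G i t - G i s))" by (rule qnorm_sum_le)
    also have "\<dots> \<le> (\<Sum>i<k. ?\<kappa> ^ Suc i * (\<theta> ^ Suc i * \<bar>t - s\<bar>))"
    proof (intro sum_mono mult_left_mono G2)
      fix i assume "i \<in> {..<k}"
      then show "\<bar>t - s\<bar> \<le> \<tau> (Suc i)" using that mono[of "Suc i" k] by auto
    qed (use \<kappa> in auto)
    also have "\<dots> = (\<Sum>i<k. \<beta> ^ Suc i) * \<bar>t - s\<bar>"
      unfolding \<theta>(2)[symmetric] power_mult_distrib sum_distrib_right by (simp add: mult.assoc)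
    also have "\<dots> \<le> 2 * \<beta> * \<bar>t - s\<bar>"
      using \<beta> \<beta>2 by (intro mult_right_mono geometric_sum_le) auto
    finally show ?thesis .
  qed
  have partial_tail: "qnorm (\<Sum>j<n. G (k + j) t) \<le> 2 * \<beta> * \<tau> k" for k n t
  proof -
    have "qnorm (\<Sum>j<n. G (k + j) t) \<le> (\<Sum>j<n. ?\<kappa> ^ Suc j * qnorm (G (k + j) t))"
      by (rule qnorm_sum_le)
    also have "\<dots> \<le> (\<Sum>j<n. ?\<kappa> ^ Suc j * (\<theta> ^ Suc j * \<tau> k))"
    proof (intro sum_mono mult_left_mono)
      fix j
      have "qnorm (G (k + j) t) \<le> \<theta> * \<tau> (k + j)" using G3[of "k + j" t] by (simp add: \<eta>_def)
      also have "\<dots> \<le> \<theta> * (\<theta> ^ j * \<tau> k)" using \<theta>(1) \<tau>_geo by (intro mult_left_mono) auto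
      finally show "qnorm (G (k + j) t) \<le> \<theta> ^ Suc j * \<tau> k" by (simp add: mult_ac)
    qed (use \<kappa> in auto)
    also have "\<dots> = (\<Sum>j<n. \<beta> ^ Suc j) * \<tau> k"
      unfolding \<theta>(2)[symmetric] power_mult_distrib sum_distrib_right by (simp add: mult.assoc)
    also have "\<dots> \<le> 2 * \<beta> * \<tau> k"
      using \<beta> \<beta>2 \<tau>0[of k] by (intro mult_right_mono geometric_sum_le) auto
    finally show ?thesis .
  qed
  have "\<exists>l. \<forall>k. qnorm (l - (\<Sum>i<k. G i t)) \<le> ?\<kappa> * (2 * \<beta> * \<tau> k)" for t
    by (rule summation_limit[OF partial_tail]) (use tendsto_mult_right_zero[OF \<tau>_lim] in simp)
  then obtain F where tail: "\<And>t k. qnorm (F t - (\<Sum>i<k. G i t)) \<le> ?\<kappa> * (2 * \<beta> * \<tau> k)" by metis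

  \<comment> \<open>Split at index \<open>k\<close>: the head \<open>H k\<close> is controlled by
    slowness, the remainder \<open>R k\<close> by amplitude.\<close>
  define H where "H k t = (\<Sum>i<k. G i t)" for k t
  define R where "R k t = F t - H k t" for k t
  have R: "qnorm (R k t - R k s) \<le> 4 * ?\<kappa>\<^sup>2 * \<beta> * \<tau> k" for k s t
  proof -
    have "qnorm (R k t - R k s) \<le> ?\<kappa> * (qnorm (R k t) + qnorm (R k s))"
      using quasi_const(2)[of "R k t" "- R k s"] by simp
    also have "\<dots> \<le> ?\<kappa> * (?\<kappa> * (2 * \<beta> * \<tau> k) + ?\<kappa> * (2 * \<beta> * \<tau> k))"
      using \<kappa> tail unfolding R_def H_def by (intro mult_left_mono add_mono) auto
    finally show ?thesis by (simp add: power2_eq_square algebra_simps)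
  qed
  note head = head[folded H_def]

  have upper: "qnorm (F t - F s) \<le> 6 * ?\<kappa> ^ 3 * \<beta> * \<tau> k" if "\<bar>t - s\<bar> \<le> \<tau> k" for k s t
  proof -
    have "F t - F s = (H k t - H k s) + (R k t - R k s)" by (simp add: R_def)
    then have "qnorm (F t - F s) \<le> ?\<kappa> * (qnorm (H k t - H k s) + qnorm (R k t - R k s))"
      using quasi_const(2) by metis
    also have "\<dots> \<le> ?\<kappa> * (2 * \<beta> * \<tau> k + 4 * ?\<kappa>\<^sup>2 * \<beta> * \<tau> k)"
    proof (intro mult_left_mono add_mono R)
      show "qnorm (H k t - H k s) \<le> 2 * \<beta> * \<tau> k"
        by (rule order_trans[OF head[OF that] mult_left_mono[OF that]]) (use \<beta> in simp)
    qed (use \<kappa> in simp)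
    also have "\<dots> = (2 * ?\<kappa> + 4 * ?\<kappa> ^ 3) * (\<beta> * \<tau> k)"
      by (simp add: algebra_simps power2_eq_square power3_eq_cube)
    also have "\<dots> \<le> (6 * ?\<kappa> ^ 3) * (\<beta> * \<tau> k)"
      using power_increasing[of 1 3 ?\<kappa>] \<kappa> \<beta> \<tau>0[of k] by (intro mult_right_mono) auto
    finally show ?thesis by (simp add: mult_ac)
  qed
  \<comment> \<open>Isolate \<open>G k\<close> between the head \<open>H k\<close> and the remainder
    \<open>R (Suc k)\<close>. The head is slow because \<open>7 * \<eta> k \<le> \<tau> k\<close>,
    and the remainder is of order \<open>\<beta> * \<eta> k\<close> because
    \<open>\<tau> (Suc k) \<le> \<eta> k\<close>. The bound on \<open>\<beta>\<close> makes both
    together at most half of what \<open>G k\<close> contributes.\<close>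
  have lower: "\<exists>t. \<bar>t - s\<bar> \<le> 7 * \<eta> k \<and> \<eta> k / (8 * ?\<kappa>\<^sup>2) \<le> qnorm (F t - F s)" for k s
  proof -
    obtain t where t: "\<bar>t - s\<bar> \<le> 7 * \<eta> k" "\<eta> k / (4 * ?\<kappa>) \<le> qnorm (G k t - G k s)"
      using G4 by blast
    have "G k t - G k s = (F t - F s) + (- (H k t - H k s) + - (R (Suc k) t - R (Suc k) s))"
      by (simp add: R_def H_def)
    then have "qnorm (G k t - G k s)
        \<le> ?\<kappa> * (qnorm (F t - F s) + qnorm (- (H k t - H k s) + - (R (Suc k) t - R (Suc k) s)))"
      using quasi_const(2) by metis
    also have "qnorm (- (H k t - H k s) + - (R (Suc k) t - R (Suc k) s))
        \<le> ?\<kappa> * (qnorm (H k t - H k s) + qnorm (R (Suc k) t - R (Suc k) s))"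
      using quasi_const(2)[of "- (H k t - H k s)" "- (R (Suc k) t - R (Suc k) s)"]
      unfolding qnorm_minus .
    also have "\<dots> \<le> ?\<kappa> * (14 * \<beta> * \<eta> k + 4 * ?\<kappa>\<^sup>2 * \<beta> * \<eta> k)"
    proof (intro mult_left_mono add_mono)
      have "qnorm (H k t - H k s) \<le> 2 * \<beta> * \<bar>t - s\<bar>"
        by (rule head[OF order_trans[OF t(1) \<eta>\<tau>]])
      also have "\<dots> \<le> 2 * \<beta> * (7 * \<eta> k)" using \<beta> by (intro mult_left_mono t(1)) auto
      finally show "qnorm (H k t - H k s) \<le> 14 * \<beta> * \<eta> k" by simp
      show "qnorm (R (Suc k) t - R (Suc k) s) \<le> 4 * ?\<kappa>\<^sup>2 * \<beta> * \<eta> k"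
        by (rule order_trans[OF R mult_left_mono[OF step]]) (use \<beta> in simp)
    qed (use \<kappa> in simp)
    also have "\<dots> = (14 * ?\<kappa> + 4 * ?\<kappa> ^ 3) * (\<beta> * \<eta> k)"
      by (simp add: algebra_simps power2_eq_square power3_eq_cube)
    also have "\<dots> \<le> (18 * ?\<kappa> ^ 3) * (\<beta> * \<eta> k)"
      using power_increasing[of 1 3 ?\<kappa>] \<kappa> \<beta> \<eta>0[of k] by (intro mult_right_mono) auto
    also have "\<dots> \<le> (18 * ?\<kappa> ^ 3) * (1 / (1000 * ?\<kappa> ^ 5) * \<eta> k)"
      using \<beta> \<kappa> \<eta>0[of k] by (intro mult_left_mono mult_right_mono) auto
    also have "\<dots> \<le> \<eta> k / (8 * ?\<kappa>\<^sup>2)"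
      using \<kappa> \<eta>0[of k] by (simp add: field_simps power_numeral_reduce)
    finally have "qnorm (G k t - G k s) \<le> ?\<kappa> * (qnorm (F t - F s) + \<eta> k / (8 * ?\<kappa>\<^sup>2))"
      using \<kappa> by simp
    with t(2) have "\<eta> k / (4 * ?\<kappa>) \<le> ?\<kappa> * (qnorm (F t - F s) + \<eta> k / (8 * ?\<kappa>\<^sup>2))" by linarith
    then have "\<eta> k / (8 * ?\<kappa>\<^sup>2) \<le> qnorm (F t - F s)"
      using \<kappa> by (simp add: field_simps power2_eq_square)
    then show ?thesis using t(1) by blast
  qed

  have "lipschitz_map qnorm F"
  proof -
    define C where "C = ?\<kappa> * (1 + ?\<kappa> * (1 + 4 * ?\<kappa>\<^sup>2))"
    have C: "4 * ?\<kappa>\<^sup>2 \<le> C"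
    proof -
      have "1 * (4 * ?\<kappa>\<^sup>2) \<le> (?\<kappa> * ?\<kappa>) * (4 * ?\<kappa>\<^sup>2)"
        using pow[of 2] by (intro mult_right_mono) (auto simp: power2_eq_square)
      also have "\<dots> \<le> C" using \<kappa> by (simp add: C_def algebra_simps)
      finally show ?thesis by simp
    qed
    have "qnorm (F t - F s) \<le> C * \<bar>t - s\<bar>" for s t
    proof -
      define d where "d = \<bar>t - s\<bar>"
      consider "d = 0" | "1 \<le> d" | "0 < d" "d < 1" by (force simp: d_def)
      then show ?thesis
      proof cases
        case 1
        then show ?thesis by (simp add: d_def)
      next
        case 2
        have "qnorm (F t - F s) \<le> 4 * ?\<kappa>\<^sup>2 * \<beta> * 1"
          using R[of 0 t s] by (simp add: R_def H_def \<tau>_simps)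
        also have "\<dots> \<le> 4 * ?\<kappa>\<^sup>2 * 1 * d" using \<beta>2 \<beta> 2 by (intro mult_mono) auto
        also have "\<dots> \<le> C * d" using C 2 by (intro mult_right_mono) auto
        finally show ?thesis by (simp add: d_def)
      next
        case 3
        \<comment> \<open>Choose \<open>k\<close> with
          \<open>\<tau> (Suc k) < d \<le> \<tau> k\<close>. Then the head is slow over the distance
          \<open>d\<close>, the single summand \<open>G k\<close> is 1-Lipschitz, and the remainder
          is bounded by a multiple of \<open>\<tau> (Suc k)\<close>, hence of
          \<open>d\<close>.\<close>
        obtain N where N: "\<tau> N < d"
          using order_tendstoD(2)[OF \<tau>_lim 3(1)] unfolding eventually_sequentially by blast
        define n where "n = (LEAST n. \<tau> n < d)"
        have n: "\<tau> n < d" unfolding n_def using N by (rule LeastI)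
        then have "n \<noteq> 0" using 3(2) \<tau>_simps(1) by (intro notI) simp
        then obtain k where k: "n = Suc k" by (cases n) auto
        have "\<not> \<tau> k < d" using not_less_Least[of k "\<lambda>n. \<tau> n < d"] k by (simp add: n_def)
        then have dk: "\<bar>t - s\<bar> \<le> \<tau> k" by (simp add: d_def)
        have "F t - F s = (H k t - H k s) + ((G k t - G k s) + (R n t - R n s))"
          by (simp add: R_def H_def k)
        then have "qnorm (F t - F s) \<le> ?\<kappa> * (qnorm (H k t - H k s) + qnorm ((G k t - G k s) + (R n t - R n s)))"
          using quasi_const(2) by metis
        also have "\<dots> \<le> ?\<kappa> * (1 * d + ?\<kappa> * (d + 4 * ?\<kappa>\<^sup>2 * d))"
        proof (intro mult_left_mono add_mono)
          have "2 * \<beta> * d \<le> 1 * d" using \<beta>2 3 by (intro mult_right_mono) auto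
          then show "qnorm (H k t - H k s) \<le> 1 * d" using head[OF dk] by (simp add: d_def)
          have "qnorm ((G k t - G k s) + (R n t - R n s)) \<le> ?\<kappa> * (qnorm (G k t - G k s) + qnorm (R n t - R n s))"
            by (rule quasi_const)
          also have "\<dots> \<le> ?\<kappa> * (d + 4 * ?\<kappa>\<^sup>2 * d)"
          proof (intro mult_left_mono add_mono)
            show "qnorm (G k t - G k s) \<le> d" using G1 by (simp add: d_def)
            have "4 * ?\<kappa>\<^sup>2 * (\<beta> * \<tau> n) \<le> 4 * ?\<kappa>\<^sup>2 * (1 * d)"
              using n \<beta> \<beta>2 \<tau>0[of n] by (intro mult_left_mono mult_mono) auto
            then show "qnorm (R n t - R n s) \<le> 4 * ?\<kappa>\<^sup>2 * d" using R[of n t s] by (simp add: mult_ac)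
          qed (use \<kappa> in simp)
          finally show "qnorm ((G k t - G k s) + (R n t - R n s)) \<le> ?\<kappa> * (d + 4 * ?\<kappa>\<^sup>2 * d)" .
        qed (use \<kappa> in simp)
        also have "\<dots> = C * d" by (simp add: C_def algebra_simps)
        finally show ?thesis by (simp add: d_def)
      qed
    qed
    then show ?thesis unfolding lipschitz_map_def by blast
  qed
  from that[OF this \<tau>0 \<tau>_lim \<eta>0 \<eta>_lim upper lower] show ?thesis .
qed

section \<open>Pointwise Lipschitz constants along null sequences of radii\<close>

lemma lower_lip_le:
  assumes \<tau>: "\<And>k. 0 < \<tau> k" "\<tau> \<longlonglongrightarrow> 0"
    and le: "\<And>k t. \<bar>t - s\<bar> \<le> \<tau> k \<Longrightarrow> qnorm (F t - F s) \<le> c * \<tau> k"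
  shows "lower_lip qnorm F s \<le> ereal c"
proof (rule ccontr)
  assume "\<not> ?thesis"
  then have "eventually (\<lambda>r. ereal c < (SUP t\<in>cball s r. ereal (qnorm (F t - F s) / r))) (at_right 0)"
    unfolding lower_lip_def by (intro less_LiminfD) (simp add: not_le)
  moreover have "filterlim \<tau> (at_right 0) sequentially"
    using \<tau> by (intro tendsto_imp_filterlim_at_right) (auto intro: always_eventually)
  ultimately obtain k where "ereal c < (SUP t\<in>cball s (\<tau> k). ereal (qnorm (F t - F s) / \<tau> k))"
    by (auto simp: filterlim_iff eventually_sequentially)
  moreover have "(SUP t\<in>cball s (\<tau> k). ereal (qnorm (F t - F s) / \<tau> k)) \<le> ereal c"
    using le[of _ k] \<tau>(1)[of k]
    by (intro SUP_least) (auto simp: divide_le_eq dist_real_def abs_minus_commute)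
  ultimately show False by simp
qed

lemma upper_lip_ge:
  assumes \<tau>: "\<And>k. 0 < \<tau> k" "\<tau> \<longlonglongrightarrow> 0"
    and ge: "\<And>k. \<exists>t. \<bar>t - s\<bar> \<le> \<tau> k \<and> c * \<tau> k \<le> qnorm (F t - F s)"
  shows "ereal c \<le> upper_lip qnorm F s"
proof (rule ccontr)
  assume "\<not> ?thesis"
  then have "eventually (\<lambda>r. (SUP t\<in>cball s r. ereal (qnorm (F t - F s) / r)) < ereal c) (at_right 0)"
    unfolding upper_lip_def by (intro Limsup_lessD) (simp add: not_le)
  moreover have "filterlim \<tau> (at_right 0) sequentially"
    using \<tau> by (intro tendsto_imp_filterlim_at_right) (auto intro: always_eventually)
  ultimately obtain k where k: "(SUP t\<in>cball s (\<tau> k). ereal (qnorm (F t - F s) / \<tau> k)) < ereal c"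
    by (auto simp: filterlim_iff eventually_sequentially)
  obtain t where "\<bar>t - s\<bar> \<le> \<tau> k" "c * \<tau> k \<le> qnorm (F t - F s)" using ge by blast
  then have "ereal c \<le> (SUP t\<in>cball s (\<tau> k). ereal (qnorm (F t - F s) / \<tau> k))"
    using \<tau>(1)[of k] by (intro SUP_upper2[of t]) (auto simp: le_divide_eq dist_real_def abs_minus_commute)
  then show False using k by simp
qed

text \<open>The oscillating map has a small lower and a large upper constant at every point, so even
  one point \<open>s\<close> with comparable constants is contradictory.\<close>

lemma lip_comparable_imp_locally_convex:
  assumes \<delta>: "0 < \<delta>" "\<delta> \<le> 1"
    and lip: "\<And>F. lipschitz_map qnorm F \<Longrightarrow> \<exists>s. ereal \<delta> * upper_lip qnorm F s \<le> lower_lip qnorm F s"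
  shows "locally_convex scl qnorm"
proof (rule ccontr)
  assume nlc: "\<not> locally_convex scl qnorm"
  let ?\<kappa> = quasi_const
  \<comment> \<open>The contradiction needs \<open>6 * ?\<kappa> ^ 3 * \<beta> < \<delta> / (56 *
    ?\<kappa> ^ 2)\<close>. The factor \<open>1000\<close> exceeds \<open>6 * 56 = 336\<close>, and
    \<open>?\<kappa> ^ 5\<close> balances the powers.\<close>
  define \<beta> where "\<beta> = \<delta> / (1000 * ?\<kappa> ^ 5)"
  have \<kappa>: "0 < ?\<kappa>" by (rule quasi_const_pos)
  have \<beta>: "0 < \<beta>" "\<beta> \<le> 1 / (1000 * ?\<kappa> ^ 5)"
    using \<delta> \<kappa> by (auto simp: \<beta>_def intro: divide_right_mono)
  obtain F and \<tau> \<eta> :: "nat \<Rightarrow> real" where F: "lipschitz_map qnorm F"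
    and \<tau>: "\<And>k. 0 < \<tau> k" "\<tau> \<longlonglongrightarrow> 0" and \<eta>: "\<And>k. 0 < \<eta> k" "\<eta> \<longlonglongrightarrow> 0"
    and up: "\<And>k s t. \<bar>t - s\<bar> \<le> \<tau> k \<Longrightarrow> qnorm (F t - F s) \<le> 6 * ?\<kappa> ^ 3 * \<beta> * \<tau> k"
    and low: "\<And>k s. \<exists>t. \<bar>t - s\<bar> \<le> 7 * \<eta> k \<and> \<eta> k / (8 * ?\<kappa>\<^sup>2) \<le> qnorm (F t - F s)"
    using not_locally_convex_oscillation[OF nlc \<beta>] by blast
  obtain s where s: "ereal \<delta> * upper_lip qnorm F s \<le> lower_lip qnorm F s" using lip[OF F] by blast
  have "lower_lip qnorm F s \<le> ereal (6 * ?\<kappa> ^ 3 * \<beta>)" by (rule lower_lip_le[OF \<tau> up])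
  moreover have "ereal (1 / (56 * ?\<kappa>\<^sup>2)) \<le> upper_lip qnorm F s"
  proof (rule upper_lip_ge[of "\<lambda>k. 7 * \<eta> k"])
    show "(\<lambda>k. 7 * \<eta> k) \<longlonglongrightarrow> 0" using tendsto_mult_right_zero[OF \<eta>(2)] by simp
  qed (use \<eta>(1) low in auto)
  then have "ereal \<delta> * ereal (1 / (56 * ?\<kappa>\<^sup>2)) \<le> ereal \<delta> * upper_lip qnorm F s"
    using \<delta> by (intro ereal_mult_left_mono) auto
  ultimately have "ereal (\<delta> * (1 / (56 * ?\<kappa>\<^sup>2))) \<le> ereal (6 * ?\<kappa> ^ 3 * \<beta>)"
    using s by (metis order_trans times_ereal.simps(1))
  then show False using \<delta> \<kappa> by (simp add: \<beta>_def field_simps power_numeral_reduce)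
qed

end

theorem theorem3:
  fixes scl :: "'k::real_normed_field \<Rightarrow> 'a::ab_group_add \<Rightarrow> 'a"
    and qnorm :: "'a \<Rightarrow> real"
  assumes "quasi_banach_space scl qnorm"
  shows
    "(locally_convex scl qnorm \<longleftrightarrow>
       (\<exists>\<delta>::real. 0 < \<delta> \<and> \<delta> \<le> 1 \<and>
         (\<forall>F. lipschitz_map qnorm F \<longrightarrow>
           (\<exists>s. ereal \<delta> * upper_lip qnorm F s \<le> lower_lip qnorm F s))))
     \<and>
     (locally_convex scl qnorm \<longleftrightarrow>
       (\<exists>\<delta>::real. 0 < \<delta> \<and> \<delta> \<le> 1 \<and>
         (\<forall>F. lipschitz_map qnorm F \<longrightarrow>
           (\<exists>s. ereal \<delta> * Limsup (at s) (\<lambda>t. ereal (qnorm (F t - F s) / \<bar>t - s\<bar>))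
                 \<le> Liminf (at s) (\<lambda>t. ereal (qnorm (F t - F s) / \<bar>t - s\<bar>))))))
     \<and>
     (locally_convex scl qnorm \<longleftrightarrow>
       (\<exists>\<delta>::real. 0 < \<delta> \<and> \<delta> \<le> 1 \<and>
         (\<forall>F. lipschitz_map qnorm F \<longrightarrow>
           (AE s in lebesgue.
              ereal \<delta> * Limsup (at s) (\<lambda>t. ereal (qnorm (F t - F s) / \<bar>t - s\<bar>))
                \<le> Liminf (at s) (\<lambda>t. ereal (qnorm (F t - F s) / \<bar>t - s\<bar>))))))"
    (is "(?i \<longleftrightarrow> ?ii) \<and> (?i \<longleftrightarrow> ?iii) \<and> (?i \<longleftrightarrow> ?iv)")
proof -
  interpret quasi_banach_space scl qnorm by (rule assms)
  \<comment> \<open>The conditions are linked in the cycle (i), (iv), (iii), (ii), (i). From (iv) to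
    (iii) it matters only that a set of full measure is nonempty.\<close>
  have 1: "?iv" if ?i using locally_convex_imp_AE[OF that] .
  have 2: "?iii" if ?iv
  proof -
    have ex: "\<exists>s. P s" if "AE s in lebesgue. P s" for P :: "real \<Rightarrow> bool"
    proof (rule ccontr)
      assume "\<not> ?thesis"
      then have "AE s::real in lebesgue. False" using that by simp
      then show False by (simp add: eventually_False ae_filter_eq_bot_iff)
    qed
    show ?thesis by (rule ex_forward[OF that]) (auto intro: ex)
  qed
  have 3: "?ii" if iii: ?iii
  proof -
    obtain \<delta> :: real where \<delta>: "0 < \<delta>" "\<delta> \<le> 1"
      and F: "\<And>F. lipschitz_map qnorm F \<Longrightarrow> \<exists>s. ereal \<delta> * Limsup (at s) (\<lambda>t. ereal (qnorm (F t - F s) / \<bar>t - s\<bar>))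
                 \<le> Liminf (at s) (\<lambda>t. ereal (qnorm (F t - F s) / \<bar>t - s\<bar>))"
      using iii by blast
    have "\<exists>s. ereal \<delta> * upper_lip qnorm F s \<le> lower_lip qnorm F s" if lip: "lipschitz_map qnorm F" for F
    proof -
      obtain s where s: "ereal \<delta> * Limsup (at s) (\<lambda>t. ereal (qnorm (F t - F s) / \<bar>t - s\<bar>))
          \<le> Liminf (at s) (\<lambda>t. ereal (qnorm (F t - F s) / \<bar>t - s\<bar>))"
        using F[OF lip] by blast
      have "ereal \<delta> * upper_lip qnorm F s
          \<le> ereal \<delta> * Limsup (at s) (\<lambda>t. ereal (qnorm (F t - F s) / \<bar>t - s\<bar>))"
        using \<delta> by (intro ereal_mult_left_mono upper_lip_le_Limsup) auto
      also note s
      also note Liminf_le_lower_lip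
      finally show ?thesis by blast
    qed
    then show ?thesis using \<delta> by blast
  qed
  have 4: "?i" if ii: ?ii
  proof -
    obtain \<delta> :: real where \<delta>: "0 < \<delta>" "\<delta> \<le> 1"
      and F: "\<And>F. lipschitz_map qnorm F \<Longrightarrow> \<exists>s. ereal \<delta> * upper_lip qnorm F s \<le> lower_lip qnorm F s"
      using ii by blast
    show ?thesis by (rule lip_comparable_imp_locally_convex[OF \<delta> F])
  qed
  show ?thesis
  proof (intro conjI iffI)
    show ?ii if ?i by (rule 3[OF 2[OF 1[OF that]]])
    show ?iii if ?i by (rule 2[OF 1[OF that]])
    show ?iv if ?i by (rule 1[OF that])
    show ?i if ?ii by (rule 4[OF that])
    show ?i if ?iii by (rule 4[OF 3[OF that]])
    show ?i if ?iv by (rule 4[OF 3[OF 2[OF that]]])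
  qed
qed

end
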